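(* Let $p$ be a prime, let $m$ be a positive integer with $\gcd(p,m)=1$, let $k$ be a nonnegative integer, and let $n=p^km$ (with $n\geq 2$). Then, in $\mathbb{Z}_p[x,y]$: (i) if $m=1$ (so $k\ge1$), $\Psi_n(x,y)\equiv (x^2+4y^2)^{\varphi(p^k)/2}$ (for $p=2$, $k=1$ this is to be read as $\Psi_2(x,y)=x$, since $x^2+4y^2\equiv x^2$ modulo $2$); (ii) if $m=2$, $\Psi_n(x,y)\equiv x^{\varphi(p^k)}$; (iii) if $m\geq 3$ and $p>2$, then with $\delta$ as defined below for odd $p$, $\Psi_n(x,y)$ factors as a product of $\varphi(m)/\delta$ distinct irreducible homogeneous polynomials of degree $\delta$, monic in $x$, each raised to the power $\varphi(p^k)$; (iv) if $m\geq 3$ and $p=2$, then with $\delta$ as defined below for $p=2$, $\Psi_n(x,y)$ factors as a product of $\varphi(m)/(2\delta)$ distinct irreducible homogeneous polynomials of degree $\delta$, monic in $x$, each raised to the power $2\varphi(2^k)$. Definition of $\delta$ for odd $p$ and $m\ge3$, $\gcd(p,m)=1$: let $u$ be the multiplicative order of $p$ modulo $2m$. Then $\delta=u/2$ if either ($p\equiv1\pmod 4$, $u$ even, and $p^{u/2}\equiv-1\pmod{2m}$), or ($p\equiv 3\pmod 4$, $u\equiv 0\pmod 4$, and $p^{u/2}\equiv -1\pmod{2m}$), or ($p\equiv3\pmod4$, $u\equiv 2\pmod 4$, and $p^{u/2}\equiv m\pm1\pmod{2m}$); $\delta=2u$ if $p\equiv 3\pmod 4$ and $u$ is odd; and $\delta=u$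 in all remaining cases. Definition of $\delta$ for $p=2$ and odd $m\geq3$: let $u'$ be the multiplicative order of $2$ modulo $m$. Then $\delta=u'/2$ if $u'$ is even and $2^{u'/2}\equiv-1\pmod m$, and $\delta=u'$ otherwise.
   Context: The Fibonacci polynomials are defined by $F_1(x)=1$, $F_2(x)=x$, and $F_n(x)=xF_{n-1}(x)+F_{n-2}(x)$ for $n\geq 3$. For $n\geq 2$, the $n$-th fibotomic polynomial $\Psi_n(x)\in\mathbb{Z}[x]$ is the product of the monic irreducible factors of $F_n(x)$ which are not factors of $F_k(x)$ for any $k<n$; also $\Psi_1(x)=1$. Thus $F_n(x)=\prod_{d\mid n}\Psi_d(x)$ for all $n\geq1$, and for $n\geq 2$, $\Psi_n(x)$ is monic of degree $\varphi(n)$, where $\varphi$ is Euler's totient function. The homogenized fibotomic polynomials are $\Psi_1(x,y)=1$ and $\Psi_n(x,y)=y^{\varphi(n)}\Psi_n(x/y)$ for $n\geq2$. $\mathbb{Z}_p$ denotes the field with $p$ elements, and factorization "in $\mathbb{Z}_p[x,y]$" refers to the reduction of the integer polynomial modulo $p$. *)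

theory Defs
  imports "HOL-Number_Theory.Number_Theory" "Berlekamp_Zassenhaus.Finite_Field"
begin

text \<open>Fibonacci polynomials over the integers: F 1 = 1, F 2 = x, F n = x F (n-1) + F (n-2).
  (F 0 = 0 is the usual extension; it is never used below, since only indices k >= 1 occur.)\<close>
fun fibpoly :: "nat \<Rightarrow> int poly" where
  "fibpoly 0 = 0"
| "fibpoly (Suc 0) = 1"
| "fibpoly (Suc (Suc n)) = [:0, 1:] * fibpoly (Suc n) + fibpoly n"

definition fibotomic :: "nat \<Rightarrow> int poly" where
  "fibotomic n = (if n = 1 then 1 else
     \<Prod>{q. irreducible q \<and> lead_coeff q = 1 \<and> q dvd fibpoly n \<and>
           (\<forall>k\<in>{1..<n}. \<not> q dvd fibpoly k)})"

text \<open>Bivariate polynomials in x,y are represented as polynomials in x with coefficients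
  in the polynomial ring in y, i.e. of type 'a poly poly (the ring R[y][x] = R[x,y]).\<close>
definition var_x :: "'a::comm_semiring_1 poly poly" where
  "var_x = monom 1 1"

definition var_y :: "'a::comm_semiring_1 poly poly" where
  "var_y = [:monom 1 1:]"

text \<open>Homogenization y^d f(x/y) of a univariate polynomial f of degree <= d.\<close>
definition homogenize :: "nat \<Rightarrow> 'a::comm_semiring_1 poly \<Rightarrow> 'a poly poly" where
  "homogenize d f = (\<Sum>i\<le>d. monom (monom (coeff f i) (d - i)) i)"

definition fibotomic_hom :: "nat \<Rightarrow> int poly poly" where
  "fibotomic_hom n = (if n = 1 then 1 else homogenize (totient n) (fibotomic n))"

definition reduce_mod :: "int poly poly \<Rightarrow> 'p::prime_card mod_ring poly poly" where
  "reduce_mod P = map_poly (map_poly of_int) P"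

definition homogeneous :: "nat \<Rightarrow> 'a::zero poly poly \<Rightarrow> bool" where
  "homogeneous d P \<longleftrightarrow> (\<forall>i j. coeff (coeff P i) j \<noteq> 0 \<longrightarrow> i + j = d)"

definition monic_in_x :: "'a::comm_semiring_1 poly poly \<Rightarrow> bool" where
  "monic_in_x P \<longleftrightarrow> lead_coeff P = 1"

definition delta_odd :: "nat \<Rightarrow> nat \<Rightarrow> nat" where
  "delta_odd p m = (let u = ord (2 * m) p in
     if (p mod 4 = 1 \<and> even u \<and> [int p ^ (u div 2) = -1] (mod int (2 * m)))
      \<or> (p mod 4 = 3 \<and> u mod 4 = 0 \<and> [int p ^ (u div 2) = -1] (mod int (2 * m)))
      \<or> (p mod 4 = 3 \<and> u mod 4 = 2 \<and>
           ([int p ^ (u div 2) = int m + 1] (mod int (2 * m)) \<or>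
            [int p ^ (u div 2) = int m - 1] (mod int (2 * m))))
     then u div 2
     else if p mod 4 = 3 \<and> odd u then 2 * u
     else u)"

definition delta_two :: "nat \<Rightarrow> nat" where
  "delta_two m = (let u = ord m 2 in
     if even u \<and> [(2::int) ^ (u div 2) = -1] (mod int m) then u div 2 else u)"

end

theory Submission
  imports Defs "Berlekamp_Zassenhaus.Distinct_Degree_Factorization"
begin

text \<open>
  Write \<open>F n\<close> for the Fibonacci polynomials and \<open>L n\<close> for the Lucas polynomials. In characteristic \<open>p\<close> the
  Frobenius map gives \<open>F (q n) = F q * (F n)\<^sup>q\<close> for \<open>q = p\<^sup>k\<close>, hence \<open>L q = x\<^sup>q\<close> (take \<open>n = 2\<close>) and
  \<open>F q = (x\<^sup>2 + 4) ^ ((q - 1) / 2)\<close> for odd \<open>p\<close>; comparing the product formulas for \<open>p\<^sup>k m\<close>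
  and \<open>m\<close>, the reduction of the fibotomic polynomial of index \<open>p\<^sup>k m\<close> is the \<open>\<phi>(p\<^sup>k)\<close>-th power of the one
  of index \<open>m\<close> as soon as \<open>m \<ge> 2\<close>.

  An irreducible \<open>f\<close> dividing some \<open>F n\<close> has a rank \<open>m\<close>: it divides \<open>F n\<close> iff \<open>m\<close> divides \<open>n\<close>. The degree of
  \<open>f\<close> is the least \<open>e > 0\<close> such that \<open>f\<close> divides \<open>x\<^sup>q - x = L q - x\<close> with \<open>q = p\<^sup>e\<close>. For \<open>q = 2 a + 1\<close> this
  difference is \<open>(x\<^sup>2 + 4) * F a * F (a + 1)\<close> or \<open>L a * L (a + 1)\<close> according to the parity of \<open>a\<close>, and for
  \<open>p = 2\<close> its square is \<open>x\<^sup>2 * F (q - 1) * F (q + 1)\<close>, so the degree depends only on \<open>p\<close> and \<open>m\<close> through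
  congruences for \<open>p\<^sup>e\<close> modulo \<open>2 m\<close> (modulo \<open>m\<close> for \<open>p = 2\<close>). The multiplicities follow since \<open>F m\<close> is
  squarefree for odd \<open>p\<close> and the square of a squarefree polynomial for \<open>p = 2\<close>.
\<close>

text \<open>\<^theory>\<open>Berlekamp_Zassenhaus.Unique_Factorization\<close> rebinds \<open>coprime\<close> to a constant of its own.\<close>
alias coprime = algebraic_semidom_class.coprime

section \<open>Fibonacci and Lucas sequences in a commutative ring\<close>

text \<open>Evaluated at an element of an arbitrary commutative ring, so that the same identities
  serve over Z[x] and over Z_p[x].\<close>

fun fib_at :: "'a::comm_ring_1 \<Rightarrow> nat \<Rightarrow> 'a" where
  "fib_at x 0 = 0"
| "fib_at x (Suc 0) = 1"
| "fib_at x (Suc (Suc n)) = x * fib_at x (Suc n) + fib_at x n"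

text \<open>Since \<open>F (n+1) - x F n = F (n-1)\<close>, this is the usual
  \<open>F (n+1) + F (n-1)\<close>, in a form that also makes sense at \<open>n = 0\<close>.\<close>

definition lucas_at :: "'a::comm_ring_1 \<Rightarrow> nat \<Rightarrow> 'a" where
  "lucas_at x n = 2 * fib_at x (Suc n) - x * fib_at x n"

lemma fib_at_2: "fib_at x 2 = x"
  by (simp add: numeral_2_eq_2)

lemma lucas_at_Suc: "lucas_at x (Suc n) = x * fib_at x (Suc n) + 2 * fib_at x n"
  by (simp add: lucas_at_def algebra_simps)

section \<open>Addition, norm and doubling identities\<close>

lemma fib_at_add:
  "fib_at x (Suc (m + n)) = fib_at x (Suc m) * fib_at x (Suc n) + fib_at x m * fib_at x n"
proof (induction m arbitrary: n)
  case (Suc m)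
  have "fib_at x (Suc (Suc m + n)) = fib_at x (Suc (m + Suc n))" by simp
  also have "\<dots> = fib_at x (Suc m) * fib_at x (Suc (Suc n)) + fib_at x m * fib_at x (Suc n)"
    by (rule Suc.IH)
  also have "\<dots> = fib_at x (Suc (Suc m)) * fib_at x (Suc n) + fib_at x (Suc m) * fib_at x n"
    by (simp add: algebra_simps)
  finally show ?case .
qed simp

lemma fib_at_cassini: "fib_at x (Suc (Suc n)) * fib_at x n - fib_at x (Suc n) ^ 2 = - ((-1) ^ n)"
proof (induction n)
  case (Suc n)
  have "fib_at x (Suc (Suc (Suc n))) * fib_at x (Suc n) - fib_at x (Suc (Suc n)) ^ 2
        = - (fib_at x (Suc (Suc n)) * fib_at x n - fib_at x (Suc n) ^ 2)"
    by (simp add: algebra_simps power2_eq_square)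
  also have "\<dots> = - ((-1) ^ Suc n)" by (simp only: Suc.IH power_Suc) simp
  finally show ?case .
qed simp

text \<open>If \<open>\<alpha>^2 = x \<alpha> + 1\<close>, then
  \<open>\<alpha>^(n+1) = F (n+1) \<alpha> + F n\<close>. The left side is minus the norm of this
  element, and \<alpha> has norm -1.\<close>

lemma fib_at_norm:
  "fib_at x (Suc n) ^ 2 - x * fib_at x n * fib_at x (Suc n) - fib_at x n ^ 2 = (-1) ^ n"
  using fib_at_cassini[of x n] by (simp add: algebra_simps power2_eq_square)

text \<open>Four times the norm form with the square completed; \<open>x^2 + 4\<close> is its
  discriminant.\<close>

lemma lucas_fib_norm:
  "lucas_at x n ^ 2 - (x ^ 2 + 4) * fib_at x n ^ 2 = 4 * (-1) ^ n"
proof -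
  have "lucas_at x n ^ 2 - (x ^ 2 + 4) * fib_at x n ^ 2
     = 4 * (fib_at x (Suc n) ^ 2 - x * fib_at x n * fib_at x (Suc n) - fib_at x n ^ 2)"
    by (simp add: lucas_at_def algebra_simps power2_eq_square)
  then show ?thesis by (simp only: fib_at_norm)
qed

lemma fib_at_double_Suc: "fib_at x (Suc (2 * n)) = fib_at x (Suc n) ^ 2 + fib_at x n ^ 2"
  using fib_at_add[of x n n] by (simp add: mult_2 power2_eq_square)

lemma fib_at_double: "fib_at x (2 * n) = fib_at x n * lucas_at x n"
proof (cases n)
  case (Suc k)
  have "fib_at x (2 * n) = fib_at x (Suc (Suc k + k))" by (simp add: Suc mult_2)
  also have "\<dots> = fib_at x (Suc k) * lucas_at x (Suc k)"
    unfolding fib_at_add lucas_at_Suc by (simp add: algebra_simps)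
  finally show ?thesis by (simp add: Suc)
qed simp

lemma lucas_at_double_Suc:
  "lucas_at x (Suc (2 * a)) = x * (fib_at x (Suc a) ^ 2 + fib_at x a ^ 2)
     + 2 * fib_at x a * (2 * fib_at x (Suc a) - x * fib_at x a)"
  unfolding lucas_at_Suc fib_at_double_Suc fib_at_double by (simp add: lucas_at_def algebra_simps)

lemma lucas_at_minus_even:
  assumes "even a"
  shows "lucas_at x (Suc (2 * a)) - x = (x ^ 2 + 4) * fib_at x a * fib_at x (Suc a)"
proof -
  \<comment> \<open>For even \<open>a\<close> the norm form equals 1. Inserting it turns the claim
    into an identity between quadratic forms in \<open>F a\<close> and
    \<open>F (a+1)\<close>.\<close>
  have "x = x * (fib_at x (Suc a) ^ 2 - x * fib_at x a * fib_at x (Suc a) - fib_at x a ^ 2)"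
    using assms by (simp add: fib_at_norm)
  then have "lucas_at x (Suc (2 * a)) - x = lucas_at x (Suc (2 * a)) - \<dots>" by simp
  also have "\<dots> = (x ^ 2 + 4) * fib_at x a * fib_at x (Suc a)"
    unfolding lucas_at_double_Suc by (simp add: algebra_simps power2_eq_square)
  finally show ?thesis .
qed

lemma lucas_at_minus_odd:
  assumes "odd a"
  shows "lucas_at x (Suc (2 * a)) - x = lucas_at x a * lucas_at x (Suc a)"
proof -
  \<comment> \<open>For odd \<open>a\<close> the norm form equals -1, whence the sign.\<close>
  have "x = - x * (fib_at x (Suc a) ^ 2 - x * fib_at x a * fib_at x (Suc a) - fib_at x a ^ 2)"
    using assms by (simp add: fib_at_norm)
  then have "lucas_at x (Suc (2 * a)) - x = lucas_at x (Suc (2 * a)) - \<dots>" by simp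
  also have "\<dots> = lucas_at x a * lucas_at x (Suc a)"
    \<comment> \<open>Two different expansions are used, so that \<open>L a\<close> and
      \<open>L (a+1)\<close> both involve only \<open>F a\<close> and
      \<open>F (a+1)\<close>.\<close>
    unfolding lucas_at_double_Suc unfolding lucas_at_def[of x a] lucas_at_Suc
    by (simp add: algebra_simps power2_eq_square)
  finally show ?thesis .
qed

text \<open>With \<open>\<alpha>\<^sup>2 = x \<alpha> + 1\<close> this is the binomial expansion of \<open>(\<alpha> F(n+1) + F(n))\<^sup>k \<alpha>\<^sup>r\<close>.\<close>
lemma fib_at_mult_expand:
  "fib_at x (k * Suc n + r) =
     (\<Sum>i\<le>k. of_nat (k choose i) * fib_at x (Suc n) ^ i * fib_at x n ^ (k - i) * fib_at x (i + r))"
proof (induction k arbitrary: r)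
  case (Suc k)
  let ?a = "fib_at x (Suc n)" and ?b = "fib_at x n"
  let ?t = "\<lambda>i. of_nat (k choose i) * ?a ^ i * ?b ^ (k - i)"
  have "fib_at x (Suc k * Suc n + r) = fib_at x (k * Suc n + (Suc n + r))" by (simp add: algebra_simps)
  also have "\<dots> = (\<Sum>i\<le>k. ?t i * fib_at x (i + (Suc n + r)))" by (rule Suc.IH)
  also have "\<dots> = (\<Sum>i\<le>k. ?t i * (?a * fib_at x (Suc (i + r)) + ?b * fib_at x (i + r)))"
    using fib_at_add[of x n "_ + r"] by (simp add: algebra_simps)
  also have "\<dots> = (\<Sum>i\<le>k. of_nat (k choose i) * ?a ^ Suc i * ?b ^ (Suc k - Suc i) * fib_at x (Suc i + r))
      + (\<Sum>i\<le>k. of_nat (k choose i) * ?a ^ i * ?b ^ (Suc k - i) * fib_at x (i + r))"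
    by (simp add: algebra_simps sum.distrib Suc_diff_le)
  also have "(\<Sum>i\<le>k. of_nat (k choose i) * ?a ^ i * ?b ^ (Suc k - i) * fib_at x (i + r))
    = (\<Sum>i\<le>Suc k. of_nat (k choose i) * ?a ^ i * ?b ^ (Suc k - i) * fib_at x (i + r))"
    by (simp add: binomial_eq_0)
  also have "\<dots> = ?b ^ Suc k * fib_at x r
     + (\<Sum>i\<le>k. of_nat (k choose Suc i) * ?a ^ Suc i * ?b ^ (Suc k - Suc i) * fib_at x (Suc i + r))"
    by (subst sum.atMost_Suc_shift) simp
  also have "(\<Sum>i\<le>k. of_nat (k choose i) * ?a ^ Suc i * ?b ^ (Suc k - Suc i) * fib_at x (Suc i + r)) + \<dots>
     = ?b ^ Suc k * fib_at x r + (\<Sum>i\<le>k. of_nat (Suc k choose Suc i) * ?a ^ Suc i * ?b ^ (Suc k - Suc i) * fib_at x (Suc i + r))"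
    by (simp add: algebra_simps sum.distrib)
  also have "\<dots> = (\<Sum>i\<le>Suc k. of_nat (Suc k choose i) * ?a ^ i * ?b ^ (Suc k - i) * fib_at x (i + r))"
    by (subst sum.atMost_Suc_shift) simp
  finally show ?case .
qed simp

text \<open>In the expansion of \<open>F (p n)\<close> with \<open>r = 0\<close> the inner binomial
  coefficients vanish and the term \<open>i = 0\<close> contains \<open>F 0 = 0\<close>, so only
  \<open>i = p\<close> survives.\<close>

lemma fib_at_prime_mult:
  fixes x :: "'a::comm_ring_1"
  assumes "prime p" and "of_nat p = (0::'a)"
  shows "fib_at x (p * n) = fib_at x p * fib_at x n ^ p"
proof (cases n)
  case 0
  then show ?thesis using assms(1) prime_gt_0_nat by (simp add: power_0_left)
next
  case (Suc j)
  let ?t = "\<lambda>i. of_nat (p choose i) * fib_at x (Suc j) ^ i * fib_at x j ^ (p - i) * fib_at x (i + 0)"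
  have zero: "?t i = 0" if "i \<in> {..p} - {p}" for i
  proof (cases "i = 0")
    case False
    with that have "p dvd (p choose i)" using assms(1) by (intro dvd_choose_prime) auto
    then obtain c where "p choose i = p * c" by blast
    then show ?thesis using assms(2) by simp
  qed simp
  have "fib_at x (p * n) = (\<Sum>i\<le>p. ?t i)"
    using fib_at_mult_expand[of x p j 0] by (simp add: Suc)
  also have "\<dots> = ?t p" using zero by (subst sum.remove[of _ p]) (simp_all add: sum.neutral)
  finally show ?thesis by (simp add: Suc mult.commute)
qed

lemma fib_at_prime_power_mult:
  fixes x :: "'a::comm_ring_1"
  assumes "prime p" and "of_nat p = (0::'a)"
  shows "fib_at x (p ^ r * n) = fib_at x (p ^ r) * fib_at x n ^ (p ^ r)"
proof (induction r)
  case (Suc r)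
  have "fib_at x (p ^ Suc r * n) = fib_at x p * (fib_at x (p ^ r) * fib_at x n ^ p ^ r) ^ p"
    using fib_at_prime_mult[OF assms, of x "p ^ r * n"] by (simp add: Suc.IH mult.assoc)
  also have "\<dots> = fib_at x (p * p ^ r) * fib_at x n ^ p ^ Suc r"
    by (simp add: fib_at_prime_mult[OF assms] power_mult_distrib power_mult[symmetric] mult_ac)
  finally show ?case by simp
qed simp

lemma lucas_at_Suc_Suc: "lucas_at x (Suc (Suc n)) = x * lucas_at x (Suc n) + lucas_at x n"
  by (simp add: lucas_at_def algebra_simps)

section \<open>Divisibility and the rank of apparition\<close>

text \<open>A common divisor of two neighbours divides the norm form, which is 1 or -1.\<close>

lemma prime_elem_not_dvd_consecutive_fib:
  assumes "prime_elem f" "f dvd fib_at x (Suc n)"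
  shows "\<not> f dvd fib_at x n"
proof
  assume "f dvd fib_at x n"
  with assms have "f dvd fib_at x (Suc n) ^ 2 - x * fib_at x n * fib_at x (Suc n) - fib_at x n ^ 2"
    by (intro dvd_diff dvd_mult) (auto simp: power2_eq_square)
  then have "f dvd 1" by (simp add: fib_at_norm minus_one_power_iff split: if_splits)
  with assms(1) show False by (simp add: prime_elem_def)
qed

text \<open>Modulo \<open>f\<close> the addition formula reads \<open>F (m+s) = F (m-1) F s\<close>,
  and \<open>f\<close> does not divide \<open>F (m-1)\<close> because it divides the neighbour
  \<open>F m\<close>.\<close>

lemma prime_elem_dvd_fib_add_iff:
  assumes "prime_elem f" "f dvd fib_at x m" "m > 0"
  shows "f dvd fib_at x (m + s) \<longleftrightarrow> f dvd fib_at x s"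
proof -
  obtain j where j: "m = Suc j" using assms(3) by (cases m) auto
  have "f dvd fib_at x (m + s) \<longleftrightarrow> f dvd fib_at x j * fib_at x s"
    using assms(2) by (simp add: j fib_at_add dvd_add_right_iff)
  also have "\<dots> \<longleftrightarrow> f dvd fib_at x s"
    using prime_elem_not_dvd_consecutive_fib[of f x j] assms by (auto simp: j prime_elem_dvd_mult_iff)
  finally show ?thesis .
qed

lemma prime_elem_dvd_fib_mod_iff:
  assumes "prime_elem f" "f dvd fib_at x m" "m > 0"
  shows "f dvd fib_at x n \<longleftrightarrow> f dvd fib_at x (n mod m)"
proof (induction n rule: less_induct)
  case (less n)
  show ?case
  proof (cases "n < m")
    case False
    then have "f dvd fib_at x n \<longleftrightarrow> f dvd fib_at x (n - m)"
      using prime_elem_dvd_fib_add_iff[OF assms, of "n - m"] by simp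
    then show ?thesis using less[of "n - m"] False assms(3) by (simp add: le_mod_geq)
  qed simp
qed

text \<open>Index 0 is left out because \<open>F 0 = 0\<close>. Over Z, the monic irreducible
  polynomials of rank \<open>n\<close> are the factors collected by
  \<open>fibotomic n\<close>.\<close>

definition has_rank :: "'a::comm_ring_1 \<Rightarrow> 'a \<Rightarrow> nat \<Rightarrow> bool" where
  "has_rank x f m \<longleftrightarrow> m > 0 \<and> f dvd fib_at x m \<and> (\<forall>k\<in>{1..<m}. \<not> f dvd fib_at x k)"

text \<open>Divisibility of \<open>F n\<close> by \<open>f\<close> depends only on
  \<open>n mod m\<close>, and no positive residue below \<open>m\<close> qualifies.\<close>

lemma has_rank_dvd_iff:
  assumes "prime_elem f" "has_rank x f m"
  shows "f dvd fib_at x n \<longleftrightarrow> m dvd n"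
proof -
  have m: "m > 0" "f dvd fib_at x m" and least: "\<And>k. 1 \<le> k \<Longrightarrow> k < m \<Longrightarrow> \<not> f dvd fib_at x k"
    using assms(2) by (auto simp: has_rank_def)
  have "f dvd fib_at x (n mod m) \<longleftrightarrow> n mod m = 0"
    using least[of "n mod m"] m(1) by (cases "n mod m = 0") auto
  then show ?thesis using prime_elem_dvd_fib_mod_iff[OF assms(1) m(2,1), of n] by (simp add: dvd_eq_mod_eq_0)
qed

lemma has_rank_exists:
  assumes "prime_elem f" "f dvd fib_at x n" "n > 0"
  obtains m where "has_rank x f m" "m dvd n"
proof -
  define m where "m = (LEAST k. 0 < k \<and> f dvd fib_at x k)"
  have "0 < m \<and> f dvd fib_at x m"
    unfolding m_def by (rule LeastI[of _ n]) (use assms in auto)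
  moreover have "\<not> f dvd fib_at x k" if "k \<in> {1..<m}" for k
  proof -
    have "\<not> (0 < k \<and> f dvd fib_at x k)"
      by (rule not_less_Least) (use that m_def in simp)
    then show ?thesis using that by simp
  qed
  ultimately have "has_rank x f m" unfolding has_rank_def by blast
  moreover from this have "m dvd n" using has_rank_dvd_iff[OF assms(1)] assms(2) by simp
  ultimately show thesis by (rule that)
qed

lemma has_rank_unique: "has_rank x f m \<Longrightarrow> has_rank x f n \<Longrightarrow> m = n"
  by (rule linorder_cases[of m n]) (auto simp: has_rank_def)

section \<open>Fibonacci polynomials over a domain\<close>

definition poly_X :: "'a::comm_ring_1 poly" where
  "poly_X = [:0, 1:]"

abbreviation fibp :: "nat \<Rightarrow> 'a::comm_ring_1 poly" where
  "fibp \<equiv> fib_at poly_X"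

lemma fibpoly_eq: "fibpoly n = fibp n"
  by (induction n rule: fibpoly.induct) (auto simp: poly_X_def)

lemma fibp_Suc_degree_monic:
  "degree (fibp (Suc n) :: 'a::idom poly) = n \<and> lead_coeff (fibp (Suc n) :: 'a::idom poly) = 1"
proof (induction n rule: less_induct)
  case (less n)
  show ?case
  proof (cases n)
    case (Suc j)
    let ?A = "poly_X * fibp (Suc j) :: 'a poly"
    have IH: "degree (fibp (Suc j) :: 'a poly) = j" "lead_coeff (fibp (Suc j) :: 'a poly) = 1"
      using less[of j] Suc by auto
    moreover from IH have "degree ?A = Suc j" by (subst degree_mult_eq) (auto simp: poly_X_def)
    moreover have "lead_coeff ?A = 1" unfolding lead_coeff_mult using IH(2) by (simp add: poly_X_def)
    ultimately have A: "degree ?A = Suc j" "lead_coeff ?A = 1" by auto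
    have "degree (fibp j :: 'a poly) < Suc j"
      using less[of "j - 1"] Suc by (cases j) auto
    with A show ?thesis using Suc
      by (simp add: degree_add_eq_left coeff_eq_0)
  qed auto
qed

lemma monic_fibp: "n > 0 \<Longrightarrow> lead_coeff (fibp n :: 'a::idom poly) = 1"
  using fibp_Suc_degree_monic[where 'a='a, of "n - 1"] by (cases n) auto

lemma degree_fibp: "n > 0 \<Longrightarrow> degree (fibp n :: 'a::idom poly) = n - 1"
  using fibp_Suc_degree_monic[where 'a='a, of "n - 1"] by simp

lemma fibp_nonzero: "n > 0 \<Longrightarrow> (fibp n :: 'a::idom poly) \<noteq> 0"
  using monic_fibp[of n, where 'a='a] by auto

text \<open>The derivative of Binet's formula \<open>sqrt D * F n = \<alpha>^n - \<beta>^n\<close>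
  with \<open>D = x^2 + 4\<close>, where \<open>\<alpha>' = \<alpha> / sqrt D\<close>. The proof
  follows the recurrence and so avoids the square root.\<close>

lemma pderiv_fibp:
  "(poly_X ^ 2 + 4) * pderiv (fibp n :: 'a::idom poly)
     = of_nat n * lucas_at poly_X n - poly_X * fibp n"
proof (induction "poly_X :: 'a poly" n rule: fib_at.induct)
  case 1
  then show ?case by simp
next
  case 2
  then show ?case by (simp add: lucas_at_def)
next
  case (3 n)
  let ?x = "poly_X :: 'a poly" and ?D = "poly_X ^ 2 + 4 :: 'a poly"
  have x': "pderiv ?x = 1" by (simp add: poly_X_def pderiv_pCons)
  have "?D * pderiv (fibp (Suc (Suc n)) :: 'a poly)
      = ?D * fibp (Suc n) + ?x * (?D * pderiv (fibp (Suc n))) + ?D * pderiv (fibp n)"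
    unfolding fib_at.simps(3) pderiv_add pderiv_mult x' by (simp only: algebra_simps) simp
  also have "\<dots> = ?D * fibp (Suc n) + ?x * (of_nat (Suc n) * lucas_at ?x (Suc n) - ?x * fibp (Suc n))
      + (of_nat n * lucas_at ?x n - ?x * fibp n)"
    by (simp only: 3)
  \<comment> \<open>Equivalent to \<open>L n + L (n+2) = D * F (n+1)\<close>.\<close>
  also have "?D * fibp (Suc n) = ?x * lucas_at ?x (Suc n) + 2 * lucas_at ?x n"
  proof -
    have "(y ^ 2 + 4) * fib_at y (Suc n) = y * lucas_at y (Suc n) + 2 * lucas_at y n" for y :: "'a poly"
      unfolding lucas_at_Suc unfolding lucas_at_def by (simp add: algebra_simps power2_eq_square)
    then show ?thesis .
  qed
  also have "?x * lucas_at ?x (Suc n) + 2 * lucas_at ?x n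
      + ?x * (of_nat (Suc n) * lucas_at ?x (Suc n) - ?x * fibp (Suc n))
      + (of_nat n * lucas_at ?x n - ?x * fibp n)
    = of_nat (Suc (Suc n)) * lucas_at ?x (Suc (Suc n)) - ?x * fibp (Suc (Suc n))"
    unfolding lucas_at_Suc_Suc fib_at.simps(3) of_nat_Suc by (simp only: algebra_simps) simp
  finally show ?case .
qed

text \<open>Modulo \<open>f\<close> the derivative formula leaves \<open>n * L n\<close>. Since
  \<open>L n ^ 2 - D * F n ^ 2\<close> is 4 or -4, \<open>f\<close> cannot divide both
  \<open>F n\<close> and \<open>L n\<close>; the condition on \<open>4 n\<close> rules out the
  divisors of \<open>n\<close> and of 4 at once.\<close>

lemma prime_elem_not_dvd_pderiv_fibp:
  fixes f :: "'a::idom poly"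
  assumes f: "prime_elem f" "f dvd fibp n" and n: "\<not> f dvd of_nat (4 * n)"
  shows "\<not> f dvd (poly_X ^ 2 + 4) * pderiv (fibp n)"
proof
  assume "f dvd (poly_X ^ 2 + 4) * pderiv (fibp n)"
  then have "f dvd of_nat n * lucas_at poly_X n"
    using f(2) dvd_add_right_iff[of f "- (poly_X * fibp n)" "of_nat n * lucas_at poly_X n"]
    by (simp only: pderiv_fibp) (metis dvd_minus_iff dvd_mult uminus_add_conv_diff)
  moreover have "\<not> f dvd of_nat n" using n by (metis dvd_mult of_nat_mult)
  ultimately have "f dvd lucas_at poly_X n" using prime_elem_dvd_multD[OF f(1)] by metis
  then have "f dvd lucas_at poly_X n ^ 2 - (poly_X ^ 2 + 4) * fibp n ^ 2"
    using f(2) by (intro dvd_diff dvd_mult) (auto simp: power2_eq_square)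
  then have "f dvd 4" by (simp only: lucas_fib_norm) (simp add: minus_one_power_iff split: if_splits)
  with n show False by (simp add: dvd_mult2)
qed

lemma square_dvd_imp_dvd_pderiv:
  fixes f :: "'a::idom poly"
  assumes "f ^ 2 dvd g"
  shows "f dvd pderiv g"
proof -
  obtain h where "g = f ^ 2 * h" using assms by blast
  then show ?thesis by (simp add: pderiv_mult power2_eq_square algebra_simps dvd_add)
qed

section \<open>Monic irreducible factors\<close>

definition monic_irreducible_factors :: "'a::idom poly \<Rightarrow> 'a poly set" where
  "monic_irreducible_factors A = {q. irreducible q \<and> lead_coeff q = 1 \<and> q dvd A}"

lemma monic_dvd_monic_irreducible_eq:
  fixes f g :: "'a::idom poly"
  assumes "irreducible f" "lead_coeff f = 1" "irreducible g" "lead_coeff g = 1" "f dvd g"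
  shows "f = g"
proof -
  obtain h where h: "g = f * h" using assms(5) by blast
  then have "h dvd 1" using assms(1,3) by (metis irreducible_def irreducible_not_unit)
  then have "degree h = 0" by (simp add: poly_dvd_1)
  moreover have "lead_coeff h = 1" using assms(2,4) h by (simp add: lead_coeff_mult)
  ultimately have "h = 1" by (metis degree0_coeffs lead_coeff_pCons(2) one_pCons)
  with h show ?thesis by simp
qed

lemma monic_irreducible_degree_pos:
  fixes f :: "'a::idom poly"
  assumes "irreducible f" "lead_coeff f = 1"
  shows "degree f > 0"
proof (rule ccontr)
  assume "\<not> degree f > 0"
  then have "f = 1" using assms(2) by (metis degree0_coeffs gr0I lead_coeff_pCons(2) one_pCons)
  with assms(1) show False by (simp add: irreducible_def)
qed

lemma monic_irreducible_divisor_exists: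
  fixes A :: "'a::{factorial_ring_gcd,semiring_gcd_mult_normalize} poly"
  assumes "lead_coeff A = 1" "A \<noteq> 1"
  obtains q B where "irreducible q" "lead_coeff q = 1" "lead_coeff B = 1" "A = q * B"
proof -
  have "A \<noteq> 0" using assms(1) by auto
  moreover have "\<not> is_unit A"
    using assms by (metis is_unit_polyE lead_coeff_pCons(2) one_pCons pCons_0_0)
  ultimately obtain q where q: "prime q" "q dvd A"
    using prime_divisor_exists[of A] by blast
  then obtain B where B: "A = q * B" by blast
  have u: "lead_coeff q * lead_coeff B = 1" using assms(1) B by (simp add: lead_coeff_mult)
  \<comment> \<open>The two leading coefficients are mutually inverse units. Scaling each factor by
    the leading coefficient of the other makes both monic without division, so this works over Z as
    well.\<close>
  let ?q = "smult (lead_coeff B) q" and ?B = "smult (lead_coeff q) B"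
  have "A = ?q * ?B" using B u by (simp add: mult.commute)
  moreover have "lead_coeff ?q = 1" "lead_coeff ?B = 1" using u by (auto simp: mult.commute)
  moreover have "irreducible ?q"
  proof -
    have "is_unit [:lead_coeff B:]" using u by (metis dvd_triv_right is_unit_const_poly_iff)
    then have "irreducible ([:lead_coeff B:] * q)"
      using q(1) by (simp only: irreducible_mult_unit_left prime_elem_imp_irreducible prime_imp_prime_elem)
    then show ?thesis by simp
  qed
  ultimately show thesis using that by blast
qed

text \<open>Monic irreducible factors are split off one at a time; squarefreeness ensures that the
  factor just removed does not return. It is applied both over Z and over Z_p.\<close>

lemma squarefree_eq_prod_factors:
  fixes A :: "'a::{factorial_ring_gcd,semiring_gcd_mult_normalize} poly"
  assumes "lead_coeff A = 1" "\<And>f. irreducible f \<Longrightarrow> lead_coeff f = 1 \<Longrightarrow> \<not> f ^ 2 dvd A"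
  shows "finite (monic_irreducible_factors A) \<and> A = \<Prod>(monic_irreducible_factors A)"
  using assms
proof (induction "degree A" arbitrary: A rule: less_induct)
  case less
  show ?case
  proof (cases "A = 1")
    case True
    then have "monic_irreducible_factors A = {}"
      by (auto simp: monic_irreducible_factors_def dest: irreducible_not_unit)
    then show ?thesis using True by simp
  next
    case False
    obtain q B where q: "irreducible q" "lead_coeff q = 1" and B: "lead_coeff B = 1" and A: "A = q * B"
      by (rule monic_irreducible_divisor_exists[OF less.prems(1) False])
    have "B \<noteq> 0" "q \<noteq> 0" using B q by auto
    then have "degree B < degree A"
      using monic_irreducible_degree_pos[OF q] by (simp add: A degree_mult_eq)
    moreover have "\<not> f ^ 2 dvd B" if "irreducible f" "lead_coeff f = 1" for f
      using less.prems(2)[OF that] A by (metis dvd_mult)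
    ultimately have IH: "finite (monic_irreducible_factors B)" "B = \<Prod>(monic_irreducible_factors B)"
      using less.hyps[of B] B by auto
    have "\<not> q dvd B" using less.prems(2)[OF q] A by (metis dvd_refl mult_dvd_mono power2_eq_square)
    then have notin: "q \<notin> monic_irreducible_factors B" by (simp add: monic_irreducible_factors_def)
    have "f dvd A \<longleftrightarrow> f = q \<or> f dvd B" if f: "irreducible f" "lead_coeff f = 1" for f
    proof -
      have "f dvd A \<longleftrightarrow> f dvd q \<or> f dvd B"
        unfolding A using irreducible_imp_prime_elem[OF f(1)] by (rule prime_elem_dvd_mult_iff)
      then show ?thesis using monic_dvd_monic_irreducible_eq[OF f q] by auto
    qed
    then have "monic_irreducible_factors A = insert q (monic_irreducible_factors B)"
      using q unfolding monic_irreducible_factors_def by blast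
    then show ?thesis using IH notin A by simp
  qed
qed

section \<open>The product formula and the degree of the fibotomic polynomials\<close>

lemma monic_irreducible_int_not_dvd_of_nat:
  fixes f :: "int poly"
  assumes "irreducible f" "lead_coeff f = 1" "n > 0"
  shows "\<not> f dvd of_nat n"
proof
  assume "f dvd of_nat n"
  moreover have "(of_nat n :: int poly) \<noteq> 0" using assms(3) by simp
  ultimately have "degree f \<le> degree (of_nat n :: int poly)" by (rule dvd_imp_degree_le)
  then show False using monic_irreducible_degree_pos[OF assms(1,2)] by simp
qed

text \<open>A monic irreducible polynomial over Z is nonconstant, so it cannot divide
  \<open>4 n\<close>, and the derivative criterion excludes double factors.\<close>

lemma fibp_int_squarefree:
  fixes f :: "int poly"
  assumes "irreducible f" "lead_coeff f = 1" "n > 0"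
  shows "\<not> f ^ 2 dvd fibp n"
proof
  assume sq: "f ^ 2 dvd fibp n"
  then have "f dvd fibp n" by (metis dvd_mult_left power2_eq_square)
  moreover have "\<not> f dvd of_nat (4 * n)"
    using monic_irreducible_int_not_dvd_of_nat[OF assms(1,2), of "4 * n"] assms(3) by simp
  ultimately have "\<not> f dvd (poly_X ^ 2 + 4) * pderiv (fibp n)"
    using assms(1) by (intro prime_elem_not_dvd_pderiv_fibp irreducible_imp_prime_elem)
  then show False using square_dvd_imp_dvd_pderiv[OF sq] by (metis dvd_mult)
qed

definition fibotomic_factors :: "nat \<Rightarrow> int poly set" where
  "fibotomic_factors n = {q. irreducible q \<and> lead_coeff q = 1 \<and> has_rank poly_X q n}"

text \<open>At \<open>n = 1\<close> the exceptional value 1 agrees with the empty product, because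
  \<open>F 1 = 1\<close> has no irreducible divisor.\<close>

lemma fibotomic_eq: "n > 0 \<Longrightarrow> fibotomic n = \<Prod>(fibotomic_factors n)"
proof (cases "n = 1")
  case True
  then have "fibotomic_factors n = {}"
    by (auto simp: fibotomic_factors_def has_rank_def irreducible_def)
  then show ?thesis using True by (simp add: fibotomic_def)
next
  case False
  assume "n > 0"
  with False show ?thesis
    unfolding fibotomic_def fibotomic_factors_def has_rank_def fibpoly_eq
    by (auto intro!: arg_cong[where f = "prod (\<lambda>x. x)"])
qed

text \<open>Sorts the factors of \<open>F n\<close> by rank, which is always a divisor of
  \<open>n\<close>.\<close>

lemma factors_fibp_eq_Union:
  assumes "n > 0"
  shows "monic_irreducible_factors (fibp n) = (\<Union>d\<in>{d. d dvd n}. fibotomic_factors d)"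
proof -
  have "q dvd fibp n \<longleftrightarrow> (\<exists>d. d dvd n \<and> has_rank poly_X q d)" if "irreducible q" for q :: "int poly"
    using irreducible_imp_prime_elem[OF that] has_rank_exists[of q] has_rank_dvd_iff[of q] assms
    by metis
  then have "q \<in> monic_irreducible_factors (fibp n) \<longleftrightarrow> q \<in> (\<Union>d\<in>{d. d dvd n}. fibotomic_factors d)" for q
    unfolding monic_irreducible_factors_def fibotomic_factors_def by (cases "irreducible q") auto
  then show ?thesis by (simp only: set_eq_iff simp_thms)
qed

lemma fibp_int_factors:
  assumes "n > 0"
  shows "finite (monic_irreducible_factors (fibp n :: int poly))"
    and "fibp n = \<Prod>(monic_irreducible_factors (fibp n :: int poly))"
  using squarefree_eq_prod_factors[of "fibp n :: int poly"] fibp_int_squarefree[of _ n] monic_fibp[of n, where 'a=int]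
    assms by auto

lemma prod_fibotomic:
  assumes "n > 0"
  shows "fibp n = (\<Prod>d | d dvd n. fibotomic d)"
proof -
  have fin: "finite (fibotomic_factors d)" if "d dvd n" for d
    by (rule finite_subset[OF _ fibp_int_factors(1)[OF assms]]) (use that factors_fibp_eq_Union[OF assms] in blast)
  have "fibp n = \<Prod>(\<Union>d\<in>{d. d dvd n}. fibotomic_factors d)"
    using fibp_int_factors(2)[OF assms] factors_fibp_eq_Union[OF assms] by simp
  also have "\<dots> = (\<Prod>d | d dvd n. \<Prod>(fibotomic_factors d))"
    using assms fin by (intro prod.UNION_disjoint)
      (auto simp: fibotomic_factors_def dest: has_rank_unique)
  also have "\<dots> = (\<Prod>d | d dvd n. fibotomic d)"
    using assms by (intro prod.cong refl) (metis dvd_pos_nat fibotomic_eq mem_Collect_eq)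
  finally show ?thesis .
qed

lemma monic_fibotomic: "n > 0 \<Longrightarrow> lead_coeff (fibotomic n) = 1"
  by (simp add: fibotomic_eq lead_coeff_prod fibotomic_factors_def)

lemma fibotomic_1: "fibotomic (Suc 0) = 1"
  by (simp add: fibotomic_def)

lemma degree_fibotomic: "n \<ge> 2 \<Longrightarrow> degree (fibotomic n) = totient n"
proof (induction n rule: less_induct)
  case (less n)
  let ?P = "{d. d dvd n} - {1, n}"
  have fin: "finite {d. d dvd n}" using less.prems by simp
  have split: "{d. d dvd n} = insert 1 (insert n ?P)" by auto
  have pos: "d > 0" if "d dvd n" for d using that less.prems dvd_pos_nat[of n d] by simp
  have "n - 1 = degree (fibp n :: int poly)" using less.prems by (simp add: degree_fibp)
  also have "\<dots> = (\<Sum>d | d dvd n. degree (fibotomic d))"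
  proof -
    have "fibotomic d \<noteq> 0" if "d \<in> {d. d dvd n}" for d
      using monic_fibotomic[of d] pos[of d] that by auto
    then show ?thesis using less.prems by (simp add: prod_fibotomic degree_prod_eq_sum_degree)
  qed
  also have "\<dots> = degree (fibotomic n) + (\<Sum>d\<in>?P. degree (fibotomic d))"
    using fin less.prems by (subst split) (simp add: fibotomic_1)
  also have "(\<Sum>d\<in>?P. degree (fibotomic d)) = (\<Sum>d\<in>?P. totient d)"
  proof (intro sum.cong refl)
    fix d assume "d \<in> ?P"
    then show "degree (fibotomic d) = totient d"
      using less.prems pos[of d] dvd_imp_le[of d n] by (intro less.IH) auto
  qed
  finally have "n = 1 + degree (fibotomic n) + (\<Sum>d\<in>?P. totient d)" using less.prems by linarith
  moreover have "(\<Sum>d | d dvd n. totient d) = 1 + totient n + (\<Sum>d\<in>?P. totient d)"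
    using fin less.prems by (subst split) simp
  moreover have "(\<Sum>d | d dvd n. totient d) = n" by (rule totient_divisor_sum)
  ultimately show ?case by linarith
qed

section \<open>Homogenization\<close>

lemma coeff_homogenize:
  "coeff (homogenize d f) i = (if i \<le> d then monom (coeff f i) (d - i) else 0)"
proof -
  have "coeff (homogenize d f) i = (\<Sum>k\<le>d. if k = i then monom (coeff f k) (d - k) else 0)"
    by (simp add: homogenize_def coeff_sum)
  then show ?thesis by simp
qed

lemma coeff_homogenize_bounded:
  "degree f \<le> d \<Longrightarrow> coeff (homogenize d f) i = monom (coeff f i) (d - i)"
  by (auto simp: coeff_homogenize coeff_eq_0)

lemma homogenize_mult:
  fixes f g :: "'a::comm_ring_1 poly"
  assumes "degree f \<le> d" "degree g \<le> e"
  shows "homogenize (d + e) (f * g) = homogenize d f * homogenize e g"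
proof (rule poly_eqI)
  fix i
  \<comment> \<open>The exponents of y add up to \<open>d + e - i\<close> only if neither
    subtraction is truncated; otherwise one of the two coefficients vanishes.\<close>
  have "coeff (homogenize d f) a * coeff (homogenize e g) (i - a)
      = monom (coeff f a * coeff g (i - a)) (d + e - i)" if "a \<le> i" for a
  proof (cases "a \<le> d \<and> i - a \<le> e")
    case True
    then have "d - a + (e - (i - a)) = d + e - i" using that by linarith
    then show ?thesis by (simp add: coeff_homogenize_bounded assms mult_monom)
  next
    case False
    then have "coeff f a = 0 \<or> coeff g (i - a) = 0" using assms by (auto simp: coeff_eq_0)
    then show ?thesis by (auto simp: coeff_homogenize_bounded assms)
  qed
  then have "coeff (homogenize d f * homogenize e g) i
      = (\<Sum>a\<le>i. monom (coeff f a * coeff g (i - a)) (d + e - i))"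
    by (simp add: coeff_mult)
  also have "\<dots> = monom (coeff (f * g) i) (d + e - i)"
    by (simp add: coeff_mult monom_hom.hom_sum)
  also have "\<dots> = coeff (homogenize (d + e) (f * g)) i"
    using order_trans[OF degree_mult_le add_mono[OF assms]] by (simp add: coeff_homogenize_bounded)
  finally show "coeff (homogenize (d + e) (f * g)) i = coeff (homogenize d f * homogenize e g) i" ..
qed

lemma homogenize_0_1: "homogenize 0 1 = (1 :: 'a::comm_ring_1 poly poly)"
  by (simp add: homogenize_def)

lemma homogenize_power:
  fixes f :: "'a::comm_ring_1 poly"
  assumes "degree f \<le> d"
  shows "homogenize (d * n) (f ^ n) = homogenize d f ^ n"
proof (induction n)
  case (Suc n)
  have "degree (f ^ n) \<le> d * n" using degree_power_le[of f n] assms by (meson mult_le_mono1 order_trans)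
  then show ?case using homogenize_mult[OF assms, of "f ^ n" "d * n"] Suc by simp
qed (simp add: homogenize_0_1)

lemma homogenize_prod:
  fixes f :: "'b \<Rightarrow> 'a::comm_ring_1 poly"
  assumes "finite S" "\<And>i. i \<in> S \<Longrightarrow> degree (f i) \<le> d i"
  shows "homogenize (\<Sum>i\<in>S. d i) (\<Prod>i\<in>S. f i) = (\<Prod>i\<in>S. homogenize (d i) (f i))"
    and "degree (\<Prod>i\<in>S. f i) \<le> (\<Sum>i\<in>S. d i)"
proof -
  have "homogenize (\<Sum>i\<in>S. d i) (\<Prod>i\<in>S. f i) = (\<Prod>i\<in>S. homogenize (d i) (f i))
      \<and> degree (\<Prod>i\<in>S. f i) \<le> (\<Sum>i\<in>S. d i)"
    using assms
  proof (induction S rule: finite_induct)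
    case (insert i S)
    then have "degree (f i) \<le> d i" "degree (prod f S) \<le> sum d S" by auto
    then have "degree (f i * prod f S) \<le> d i + sum d S"
      using degree_mult_le[of "f i" "prod f S"] by linarith
    with insert show ?case by (simp add: homogenize_mult)
  qed (simp add: homogenize_0_1)
  then show "homogenize (\<Sum>i\<in>S. d i) (\<Prod>i\<in>S. f i) = (\<Prod>i\<in>S. homogenize (d i) (f i))"
    and "degree (\<Prod>i\<in>S. f i) \<le> (\<Sum>i\<in>S. d i)" by auto
qed

section \<open>Specialization at y = 1 and irreducibility of homogenizations\<close>

lemma homogeneous_homogenize: "homogeneous d (homogenize d f)"
  by (auto simp: homogeneous_def coeff_homogenize split: if_splits)

lemma lead_coeff_homogenize_monic:
  fixes f :: "'a::comm_ring_1 poly"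
  assumes "lead_coeff f = 1"
  shows "lead_coeff (homogenize (degree f) f) = 1"
proof -
  have "degree (homogenize (degree f) f) = degree f"
    by (intro antisym degree_le le_degree) (use assms in \<open>auto simp: coeff_homogenize\<close>)
  then show ?thesis using assms by (simp add: coeff_homogenize monom_eq_1)
qed

definition dehomogenize :: "'a::comm_ring_1 poly poly \<Rightarrow> 'a poly" where
  "dehomogenize P = map_poly (\<lambda>c. poly c 1) P"

lemma coeff_dehomogenize: "coeff (dehomogenize P) i = poly (coeff P i) 1"
  by (simp add: dehomogenize_def coeff_map_poly)

lemma dehomogenize_mult: "dehomogenize (P * Q) = dehomogenize P * dehomogenize Q"
  by (rule poly_eqI) (simp add: coeff_dehomogenize coeff_mult poly_sum)

lemma dehomogenize_homogenize: "degree f \<le> d \<Longrightarrow> dehomogenize (homogenize d f) = f"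
  by (rule poly_eqI) (simp add: coeff_dehomogenize coeff_homogenize_bounded poly_monom)

text \<open>Setting y = 1 turns nonunits such as y into units. A unit leading coefficient in x
  prevents this: the degree in x is preserved, hence it is 0.\<close>

lemma is_unit_if_dehomogenize_unit:
  fixes P :: "'a::field poly poly"
  assumes "is_unit (lead_coeff P)" "is_unit (dehomogenize P)"
  shows "is_unit P"
proof -
  obtain c where c: "lead_coeff P = [:c:]" "c dvd 1"
    using assms(1) by (rule is_unit_polyE)
  have "coeff (dehomogenize P) (degree P) = c" using c by (simp add: coeff_dehomogenize)
  then have "degree P \<le> degree (dehomogenize P)" using c by (intro le_degree) auto
  also have "\<dots> = 0" using assms(2) by (simp add: poly_dvd_1)
  finally have "P = [:lead_coeff P:]" by (metis degree0_coeffs le_zero_eq lead_coeff_pCons(2))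
  then show ?thesis using assms(1) by (metis is_unit_const_poly_iff)
qed

text \<open>In a factorization of the monic form both leading coefficients in x are units, so a
  factor that becomes a unit at y = 1 is itself a unit.\<close>

lemma irreducible_homogenize:
  fixes f :: "'a::field poly"
  assumes "irreducible f" "lead_coeff f = 1"
  shows "irreducible (homogenize (degree f) f)"
proof (rule irreducibleI)
  let ?H = "homogenize (degree f) f"
  have lc: "lead_coeff ?H = 1" using assms(2) by (rule lead_coeff_homogenize_monic)
  show "?H \<noteq> 0" using lc by auto
  show "\<not> is_unit ?H"
  proof
    assume "is_unit ?H"
    then obtain Q where "1 = ?H * Q" by blast
    from arg_cong[OF this, of dehomogenize] have "dehomogenize 1 = f * dehomogenize Q"
      by (simp only: dehomogenize_mult dehomogenize_homogenize[OF order_refl])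
    moreover have "dehomogenize 1 = (1 :: 'a poly)" by (simp add: dehomogenize_def)
    ultimately show False using assms(1) irreducible_not_unit by (metis dvd_triv_left)
  qed
  fix A B assume AB: "?H = A * B"
  then have "lead_coeff A * lead_coeff B = 1" using lc by (simp add: lead_coeff_mult)
  then have u: "is_unit (lead_coeff A)" "is_unit (lead_coeff B)"
    by (metis dvd_triv_left, metis dvd_triv_right)
  have "f = dehomogenize A * dehomogenize B"
    using arg_cong[OF AB, of dehomogenize] by (simp add: dehomogenize_mult dehomogenize_homogenize)
  then have "is_unit (dehomogenize A) \<or> is_unit (dehomogenize B)"
    using assms(1) irreducibleD by blast
  then show "is_unit A \<or> is_unit B" using is_unit_if_dehomogenize_unit u by blast
qed

section \<open>Reduction modulo p and the forms of x and x^2 + 4\<close>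

lemma reduce_mod_homogenize:
  "(reduce_mod (homogenize d f) :: 'p::prime_card mod_ring poly poly) = homogenize d (map_poly of_int f)"
  by (intro poly_eqI) (simp add: reduce_mod_def coeff_map_poly coeff_homogenize)

lemma homogenize_poly_X: "homogenize (Suc 0) poly_X = var_x"
  by (simp add: homogenize_def poly_X_def var_x_def)

lemma homogenize_discriminant:
  "homogenize 2 (poly_X ^ 2 + 4) = (var_x ^ 2 + 4 * var_y ^ 2 :: 'a::comm_ring_1 poly poly)"
proof (intro poly_eqI)
  fix i j
  have 4: "(4 :: 'a poly) = [:4:]" "(4 :: 'a poly poly) = [:[:4:]:]" 
    by (simp_all add: numeral_poly)
  have *: "poly_X ^ 2 + 4 = ([:4, 0, 1:] :: 'a poly)"
    by (simp add: poly_X_def power2_eq_square 4)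
  have **: "(var_x ^ 2 + 4 * var_y ^ 2 :: 'a poly poly) = [:monom 4 2, 0, 1:]"
    by (simp add: var_x_def var_y_def 4 monom_altdef power2_eq_square mult_monom numeral_2_eq_2)
  show "coeff (coeff (homogenize 2 (poly_X ^ 2 + 4)) i) j
      = coeff (coeff (var_x ^ 2 + 4 * var_y ^ 2 :: 'a poly poly) i) j"
    unfolding * ** by (auto simp: coeff_homogenize coeff_pCons numeral_2_eq_2 split: nat.splits)
qed

section \<open>The degree \<open>\<delta>\<close> as the least solution of congruences\<close>

text \<open>For odd \<open>p\<close> prime to \<open>m\<close> this will be the condition for a
  factor of rank \<open>m\<close> to divide \<open>x^q - x\<close>, where
  \<open>q = p^e = 2 a + 1\<close>. The test modulo 4 detects the parity of
  \<open>a\<close>.\<close>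

definition frobenius_cong :: "nat \<Rightarrow> nat \<Rightarrow> nat \<Rightarrow> bool" where
  "frobenius_cong p m e \<longleftrightarrow>
     (if p ^ e mod 4 = 1
      then [int (p ^ e) = 1] (mod int (2 * m)) \<or> [int (p ^ e) = -1] (mod int (2 * m))
      else [int (p ^ e) = int m + 1] (mod int (2 * m)) \<or> [int (p ^ e) = int m - 1] (mod int (2 * m)))"

text \<open>The order divides \<open>2 e\<close> but not \<open>e\<close>, so \<open>e\<close> is an
  odd multiple of half the order. A congruence for \<open>p^e\<close> can therefore be tested at
  half the order, as in the definition of \<delta>.\<close>

lemma square_root_of_unity_exponent:
  fixes p N e :: nat
  assumes "[p ^ (2 * e) = 1] (mod N)" "\<not> [p ^ e = 1] (mod N)"
  obtains c where "even (ord N p)" "odd c" "e = ord N p div 2 * c" "[p ^ (ord N p div 2) = p ^ e] (mod N)"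
proof -
  let ?u = "ord N p"
  have "?u dvd 2 * e" "\<not> ?u dvd e" using assms by (simp_all only: ord_divides simp_thms)
  then obtain c where c: "2 * e = ?u * c" by blast
  have "odd c"
  proof
    assume "even c"
    then obtain k where "c = 2 * k" by blast
    with c have "e = ?u * k" by simp
    with \<open>\<not> ?u dvd e\<close> show False by simp
  qed
  moreover have "even ?u" using c \<open>odd c\<close> by (metis dvd_triv_left even_mult_iff)
  moreover from this c have e: "e = ?u div 2 * c" by auto
  moreover have "[p ^ (?u div 2) = p ^ e] (mod N)"
  proof -
    obtain k where k: "c = 2 * k + 1" using \<open>odd c\<close> by (elim oddE)
    have "e = ?u div 2 + ?u * k" using e k \<open>even ?u\<close> by (auto simp: algebra_simps)
    then have "p ^ e = p ^ (?u div 2) * (p ^ ?u) ^ k" by (simp add: power_add power_mult)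
    moreover have "[p ^ (?u div 2) * (p ^ ?u) ^ k = p ^ (?u div 2) * 1 ^ k] (mod N)"
      by (intro cong_mult cong_pow cong_refl) (rule ord)
    ultimately show ?thesis by (simp add: cong_sym)
  qed
  ultimately show thesis using that by blast
qed

lemma cong_minus_one_imp:
  fixes p e N :: nat
  assumes "[int (p ^ e) = -1] (mod int N)" "N \<ge> 3"
  shows "[p ^ (2 * e) = 1] (mod N)" "\<not> [p ^ e = 1] (mod N)"
proof -
  have "[int (p ^ e) ^ 2 = (-1) ^ 2] (mod int N)" using assms(1) by (rule cong_pow)
  then have "[int (p ^ (2 * e)) = int 1] (mod int N)" by (simp add: power_mult mult.commute[of 2])
  then show "[p ^ (2 * e) = 1] (mod N)" by (simp only: cong_int_iff)
  show "\<not> [p ^ e = 1] (mod N)"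
  proof
    assume "[p ^ e = 1] (mod N)"
    then have "[int (p ^ e) = int 1] (mod int N)" by (simp only: cong_int_iff)
    with assms(1) have "[-1 = int 1] (mod int N)" using cong_trans cong_sym by blast
    then have "int N dvd 2" by (simp add: cong_iff_dvd_diff)
    then show False using assms(2) by (auto dest: zdvd_imp_le)
  qed
qed

text \<open>Modulo 2 the hypothesis forces \<open>m\<close> to be even, since \<open>p^e\<close> is
  odd. Then \<open>m^2\<close> is a multiple of \<open>2 m\<close>, and \<open>m + 1\<close> and
  \<open>m - 1\<close> are square roots of 1 modulo \<open>2 m\<close> other than 1.\<close>

lemma cong_m_plus_minus_one_imp:
  fixes p e m :: nat
  assumes "[int (p ^ e) = int m + 1] (mod int (2 * m)) \<or> [int (p ^ e) = int m - 1] (mod int (2 * m))"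
    and "m \<ge> 3" "odd p"
  shows "[p ^ (2 * e) = 1] (mod (2 * m))" "\<not> [p ^ e = 1] (mod (2 * m))"
proof -
  obtain s :: int where s: "s = 1 \<or> s = -1" "[int (p ^ e) = int m + s] (mod int (2 * m))"
    using assms(1) by (metis add_uminus_conv_diff)
  have "[int (p ^ e) = int m + s] (mod 2)"
    using s(2) by (rule cong_dvd_modulus) simp
  moreover have "odd (int (p ^ e))" using assms(3) by simp
  ultimately have "odd (int m + s)" by (metis cong_def even_iff_mod_2_eq_zero)
  then have "even m" using s(1) by auto
  then obtain t where t: "m = 2 * t" by blast
  have "[int (p ^ e) ^ 2 = (int m + s) ^ 2] (mod int (2 * m))" using s(2) by (rule cong_pow)
  moreover have "(int m + s) ^ 2 = 1 + int (2 * m) * (int t + s)"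
    using s(1) t by (auto simp: power2_eq_square algebra_simps)
  ultimately have "[int (p ^ e) ^ 2 = 1 + int (2 * m) * (int t + s)] (mod int (2 * m))" by simp
  then have "[int (p ^ e) ^ 2 = 1] (mod int (2 * m))"
    by (simp add: cong_def mod_add_eq)
  then have "[int (p ^ (2 * e)) = int 1] (mod int (2 * m))" by (simp add: power_mult mult.commute[of 2])
  then show "[p ^ (2 * e) = 1] (mod (2 * m))" by (simp only: cong_int_iff)
  show "\<not> [p ^ e = 1] (mod (2 * m))"
  proof
    assume "[p ^ e = 1] (mod (2 * m))"
    then have "[int (p ^ e) = int 1] (mod int (2 * m))" by (simp only: cong_int_iff)
    with s(2) have "[int m + s = int 1] (mod int (2 * m))" using cong_trans cong_sym by blast
    then have "int (2 * m) dvd int m + s - 1" by (simp add: cong_iff_dvd_diff)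
    moreover have "0 < int m + s - 1" "int m + s - 1 < int (2 * m)" using s(1) assms(2) by auto
    ultimately show False using zdvd_imp_le by fastforce
  qed
qed

section \<open>The exponent \<delta> for odd p\<close>

lemma power_mod_4_if_1: "p mod 4 = 1 \<Longrightarrow> p ^ e mod 4 = (1::nat)"
  by (metis mod_less one_less_numeral_iff power_mod power_one semiring_norm(76))

lemma power_mod_4_if_3:
  assumes "p mod 4 = (3::nat)"
  shows "p ^ e mod 4 = (if even e then 1 else 3)"
proof (induction e)
  case (Suc e)
  have "p ^ Suc e mod 4 = (p mod 4) * (p ^ e mod 4) mod 4" by (simp add: mod_mult_eq)
  then show ?case using Suc assms by auto
qed simp

lemma power_mod_4_eq_1_iff: "p mod 4 = (3::nat) \<Longrightarrow> p ^ e mod 4 = 1 \<longleftrightarrow> even e"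
  by (simp only: power_mod_4_if_3) simp

lemma odd_mod_4: "odd (p::nat) \<Longrightarrow> p mod 4 = 1 \<or> p mod 4 = 3"
  by presburger

context
  fixes p m :: nat
  assumes p: "odd p" and m: "m \<ge> 3" and cop: "coprime p m"
begin

lemma delta_odd_pos: "delta_odd p m > 0"
proof -
  have "coprime (2 * m) p" using p cop by (simp add: algebraic_semidom_class.coprime_commute[of _ p])
  then have "ord (2 * m) p > 0" by (simp add: ord_eq_0)
  moreover have "ord (2 * m) p div 2 > 0" if "ord (2 * m) p mod 4 = 2 \<or> ord (2 * m) p mod 4 = 0 \<or> even (ord (2 * m) p)"
    using that calculation by presburger
  ultimately show ?thesis unfolding delta_odd_def Let_def by auto
qed

text \<open>If \<open>p^e\<close> is 1 modulo \<open>2 m\<close>, then \<open>u\<close> divides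
  \<open>e\<close>. Otherwise \<open>e\<close> is an odd multiple of \<open>u div 2\<close>, the
  congruence moves to the exponent \<open>u div 2\<close>, and \<delta> is
  \<open>u div 2\<close>.\<close>

lemma frobenius_cong_imp_delta_odd_dvd:
  assumes "frobenius_cong p m e"
  shows "delta_odd p m dvd e"
proof -
  define u where "u = ord (2 * m) p"
  have u_dvd: "u dvd k \<longleftrightarrow> [p ^ k = 1] (mod (2 * m))" for k by (simp only: u_def ord_divides)
  have delta: "delta_odd p m = (if (p mod 4 = 1 \<and> even u \<and> [int (p ^ (u div 2)) = -1] (mod int (2 * m)))
      \<or> (p mod 4 = 3 \<and> u mod 4 = 0 \<and> [int (p ^ (u div 2)) = -1] (mod int (2 * m)))
      \<or> (p mod 4 = 3 \<and> u mod 4 = 2 \<and>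
           ([int (p ^ (u div 2)) = int m + 1] (mod int (2 * m)) \<or>
            [int (p ^ (u div 2)) = int m - 1] (mod int (2 * m))))
     then u div 2
     else if p mod 4 = 3 \<and> odd u then 2 * u
     else u)"
    unfolding delta_odd_def Let_def u_def of_nat_power by (rule refl)
  have int_1: "[int (p ^ e) = 1] (mod int (2 * m)) \<longleftrightarrow> [p ^ e = 1] (mod (2 * m))"
    using cong_int_iff[of "p ^ e" 1 "2 * m"] by (simp only: of_nat_1)
  have "(p ^ e mod 4 = 1 \<and> [p ^ e = 1] (mod (2 * m))) \<or> (p ^ e mod 4 = 1 \<and> [int (p ^ e) = -1] (mod int (2 * m)))
      \<or> (p ^ e mod 4 \<noteq> 1 \<and> ([int (p ^ e) = int m + 1] (mod int (2 * m)) \<or> [int (p ^ e) = int m - 1] (mod int (2 * m))))"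
    using assms unfolding frobenius_cong_def int_1
    by (cases "p ^ e mod 4 = 1") (simp_all only: if_True if_False simp_thms)
  then consider (one) "p ^ e mod 4 = 1" "[p ^ e = 1] (mod (2 * m))"
    | (minus) "p ^ e mod 4 = 1" "[int (p ^ e) = -1] (mod int (2 * m))"
    | (mid) "p ^ e mod 4 \<noteq> 1" "[int (p ^ e) = int m + 1] (mod int (2 * m)) \<or> [int (p ^ e) = int m - 1] (mod int (2 * m))"
    by satx
  then show ?thesis
  proof cases
    case one
    then have "u dvd e" using u_dvd by simp
    \<comment> \<open>Here \<open>p^e\<close> is also 1 modulo 4, which makes \<open>e\<close> even;
      this is the source of the value \<open>2 u\<close>.\<close>
    moreover have "2 * u dvd e" if "p mod 4 = 3" "odd u"
    proof -
      have "even e" using one(1) unfolding power_mod_4_eq_1_iff[OF that(1)] .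
      then show ?thesis using \<open>u dvd e\<close> that(2) by (simp add: divides_mult)
    qed
    moreover have "u div 2 dvd u" if "even u" using that by auto
    moreover have "even u" if "u mod 4 = 0 \<or> u mod 4 = 2" using that by presburger
    ultimately show ?thesis unfolding delta by (auto intro: dvd_trans)
  next
    case minus
    have "[p ^ (2 * e) = 1] (mod (2 * m))" "\<not> [p ^ e = 1] (mod (2 * m))"
      using cong_minus_one_imp[OF minus(2)] m by auto
    then obtain c where c: "even u" "odd c" "e = u div 2 * c" "[p ^ (u div 2) = p ^ e] (mod (2 * m))"
      unfolding u_def by (rule square_root_of_unity_exponent)
    have "[int (p ^ (u div 2)) = -1] (mod int (2 * m))"
      using c(4) minus(2) by (metis cong_int_iff cong_trans)
    \<comment> \<open>As \<open>c\<close> is odd, \<open>u div 2\<close> has the parity of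
      \<open>e\<close>, and this determines \<open>u\<close> modulo 4.\<close>
    moreover have "u mod 4 = 0" if "p mod 4 = 3"
    proof -
      have "even e" using minus(1) unfolding power_mod_4_eq_1_iff[OF that] .
      then have "even (u div 2)" using c(2,3) by auto
      then show ?thesis using c(1) by presburger
    qed
    ultimately have "delta_odd p m = u div 2" unfolding delta using c(1) odd_mod_4[OF p] by auto
    then show ?thesis using c(3) by simp
  next
    case mid
    have p3: "p mod 4 = 3" using mid(1) power_mod_4_if_1[of p e] odd_mod_4[OF p] by auto
    have "[p ^ (2 * e) = 1] (mod (2 * m))" "\<not> [p ^ e = 1] (mod (2 * m))"
      using cong_m_plus_minus_one_imp[OF mid(2) m p] by auto
    then obtain c where c: "even u" "odd c" "e = u div 2 * c" "[p ^ (u div 2) = p ^ e] (mod (2 * m))"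
      unfolding u_def by (rule square_root_of_unity_exponent)
    have "[int (p ^ (u div 2)) = int m + 1] (mod int (2 * m)) \<or>
            [int (p ^ (u div 2)) = int m - 1] (mod int (2 * m))"
      using c(4) mid(2) by (metis cong_int_iff cong_trans)
    moreover have "u mod 4 = 2"
    proof -
      have "odd e" using mid(1) unfolding power_mod_4_eq_1_iff[OF p3] .
      then have "odd (u div 2)" using c(3) by auto
      then show ?thesis using c(1) by presburger
    qed
    ultimately have "delta_odd p m = u div 2" unfolding delta using p3 by auto
    then show ?thesis using c(3) by simp
  qed
qed

text \<open>In each branch \<open>p^\<delta>\<close> is known modulo 4 from \<open>p mod 4\<close>
  and the parity of \<delta>, and modulo \<open>2 m\<close> from the branch condition or from the
  order. So \<delta> is itself a solution and, by the preceding lemma, divides all others.\<close>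

lemma frobenius_cong_delta_odd: "frobenius_cong p m (delta_odd p m)"
proof -
  define u where "u = ord (2 * m) p"
  define A where "A \<longleftrightarrow> [int (p ^ (u div 2)) = -1] (mod int (2 * m))"
  define B where "B \<longleftrightarrow> [int (p ^ (u div 2)) = int m + 1] (mod int (2 * m)) \<or>
            [int (p ^ (u div 2)) = int m - 1] (mod int (2 * m))"
  have delta: "delta_odd p m = (if (p mod 4 = 1 \<and> even u \<and> A)
      \<or> (p mod 4 = 3 \<and> u mod 4 = 0 \<and> A) \<or> (p mod 4 = 3 \<and> u mod 4 = 2 \<and> B)
     then u div 2 else if p mod 4 = 3 \<and> odd u then 2 * u else u)"
    unfolding delta_odd_def Let_def u_def A_def B_def of_nat_power by (rule refl)
  have one: "[int (p ^ (u * k)) = 1] (mod int (2 * m))" for k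
  proof -
    have "[p ^ (u * k) = 1] (mod (2 * m))" by (simp only: u_def ord_divides dvd_triv_left)
    then show ?thesis by (metis cong_int_iff of_nat_1)
  qed
  show ?thesis
  proof (cases "(p mod 4 = 1 \<and> even u \<and> A) \<or> (p mod 4 = 3 \<and> u mod 4 = 0 \<and> A)
      \<or> (p mod 4 = 3 \<and> u mod 4 = 2 \<and> B)")
    case True
    then have d: "delta_odd p m = u div 2" using delta by (simp only: if_True)
    from True show ?thesis
    proof (elim disjE conjE)
      assume "p mod 4 = 1" A
      then show ?thesis using power_mod_4_if_1[of p "u div 2"]
        unfolding frobenius_cong_def d A_def by simp
    next
      assume "p mod 4 = 3" "u mod 4 = 0" A
      moreover from this have "even (u div 2)" by presburger
      ultimately show ?thesis using power_mod_4_if_3[of p "u div 2"]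
        unfolding frobenius_cong_def d A_def by simp
    next
      assume "p mod 4 = 3" "u mod 4 = 2" B
      moreover from this have "odd (u div 2)" by presburger
      ultimately show ?thesis using power_mod_4_if_3[of p "u div 2"]
        unfolding frobenius_cong_def d B_def by simp
    qed
  next
    case False
    then have d: "delta_odd p m = (if p mod 4 = 3 \<and> odd u then 2 * u else u)"
      using delta by (simp only: if_False)
    show ?thesis
    proof (cases "p mod 4 = 3 \<and> odd u")
      case True
      then have "delta_odd p m = u * 2" using d by (simp add: mult.commute)
      moreover have "p ^ (u * 2) mod 4 = 1" using power_mod_4_if_3[of p "u * 2"] True by simp
      ultimately show ?thesis using one[of 2] unfolding frobenius_cong_def by (simp only: if_True simp_thms)
    next
      case False
      then have "delta_odd p m = u * 1" using d by (simp only: if_False mult_1_right)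
      moreover have "p ^ (u * 1) mod 4 = 1"
        using power_mod_4_if_1[of p u] power_mod_4_if_3[of p u] False odd_mod_4[OF p] by auto
      ultimately show ?thesis using one[of 1] unfolding frobenius_cong_def by (simp only: if_True simp_thms)
    qed
  qed
qed

end

text \<open>The same argument modulo \<open>m\<close>: a solution \<open>e\<close> is a multiple of
  the order or an odd multiple of half the order.\<close>

lemma delta_two_properties:
  assumes "odd m" "m \<ge> 3"
  shows "delta_two m > 0"
    and "[int (2 ^ delta_two m) = 1] (mod int m) \<or> [int (2 ^ delta_two m) = -1] (mod int m)"
    and "[int (2 ^ e) = 1] (mod int m) \<or> [int (2 ^ e) = -1] (mod int m) \<Longrightarrow> delta_two m dvd e"
proof -
  define u where "u = ord m 2"
  have delta: "delta_two m = (if even u \<and> [int (2 ^ (u div 2)) = -1] (mod int m) then u div 2 else u)"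
    by (simp add: delta_two_def Let_def u_def)
  have "coprime m 2" using assms(1) by simp
  then have "u > 0" by (simp add: u_def ord_eq_0)
  then show "delta_two m > 0" unfolding delta by (auto elim: evenE)
  have "[2 ^ u = 1] (mod m)" unfolding u_def by (rule ord)
  then have "[int (2 ^ u) = 1] (mod int m)" by (metis cong_int_iff of_nat_1)
  then show "[int (2 ^ delta_two m) = 1] (mod int m) \<or> [int (2 ^ delta_two m) = -1] (mod int m)"
    unfolding delta by (auto split: if_splits)
  assume "[int (2 ^ e) = 1] (mod int m) \<or> [int (2 ^ e) = -1] (mod int m)"
  then consider (one) "[2 ^ e = 1] (mod m)" | (minus) "[int (2 ^ e) = -1] (mod int m)"
    by (metis cong_int_iff of_nat_1)
  then show "delta_two m dvd e"
  proof cases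
    case one
    then have "u dvd e" by (simp only: u_def ord_divides)
    moreover have "u div 2 dvd u" if "even u" using that by auto
    ultimately show ?thesis unfolding delta by (auto intro: dvd_trans)
  next
    case minus
    obtain c where c: "even u" "e = u div 2 * c" "[2 ^ (u div 2) = 2 ^ e] (mod m)"
      using square_root_of_unity_exponent[OF cong_minus_one_imp[OF minus assms(2)]] unfolding u_def by metis
    have "[int (2 ^ (u div 2)) = -1] (mod int m)"
      using c(3) minus by (metis cong_int_iff cong_trans)
    then have "delta_two m = u div 2" unfolding delta using c(1) by simp
    then show ?thesis using c(2) by simp
  qed
qed

section \<open>Fibonacci polynomials in characteristic \<open>p\<close>\<close>

lemma prime_CARD: "prime CARD('p::prime_card)"
  using prime_card by blast

lemma of_nat_mod_ring_poly_eq_0_iff: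
  "(of_nat n :: 'p::prime_card mod_ring poly) = 0 \<longleftrightarrow> CARD('p) dvd n"
proof
  assume "(of_nat n :: 'p mod_ring poly) = 0"
  then have "(of_nat n :: 'p mod_ring) = 0" by (simp add: of_nat_poly)
  then show "CARD('p) dvd n" by (rule of_nat_0_mod_ring_dvd)
qed (auto simp: of_nat_poly)

lemma fibp_frobenius:
  "(fibp (CARD('p) ^ r * n) :: 'p::prime_card mod_ring poly)
     = fibp (CARD('p) ^ r) * fibp n ^ (CARD('p) ^ r)"
  by (rule fib_at_prime_power_mult) (simp_all add: prime_CARD of_nat_mod_ring_poly_eq_0_iff)

lemma lucas_frobenius:
  "(lucas_at poly_X (CARD('p) ^ r) :: 'p::prime_card mod_ring poly) = poly_X ^ (CARD('p) ^ r)"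
proof -
  let ?q = "CARD('p) ^ r"
  have "fibp ?q * lucas_at poly_X ?q = (fibp (?q * 2) :: 'p mod_ring poly)"
    by (simp only: fib_at_double mult.commute[of ?q 2])
  also have "\<dots> = fibp ?q * poly_X ^ ?q" by (simp only: fibp_frobenius fib_at_2)
  finally show ?thesis using fibp_nonzero[of ?q, where 'a="'p mod_ring"] prime_CARD[where 'p='p]
    by (simp add: prime_gt_0_nat)
qed

lemma poly_X_nonzero: "(poly_X :: 'a::comm_ring_1 poly) \<noteq> 0"
  by (simp add: poly_X_def)

lemma discriminant_monic:
  "degree (poly_X ^ 2 + 4 :: 'a::comm_ring_1 poly) = 2" "lead_coeff (poly_X ^ 2 + 4 :: 'a poly) = 1"
proof -
  have "poly_X ^ 2 + 4 = ([:4, 0, 1:] :: 'a poly)"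
    by (simp add: poly_X_def power2_eq_square numeral_poly)
  then show "degree (poly_X ^ 2 + 4 :: 'a poly) = 2" "lead_coeff (poly_X ^ 2 + 4 :: 'a poly) = 1"
    by simp_all
qed

text \<open>With \<open>D = x^2 + 4\<close>, the norm identity at the odd index \<open>q\<close>
  reads \<open>D * F q ^ 2 = L q ^ 2 + 4 = x^(2 q) + 4 = D^q\<close>. Cancelling \<open>D\<close>
  and taking the square root leaves a sign, which the leading coefficients fix.\<close>

lemma fibp_prime_power_odd:
  assumes "odd CARD('p::prime_card)"
  shows "(fibp (CARD('p) ^ r) :: 'p mod_ring poly) = (poly_X ^ 2 + 4) ^ ((CARD('p) ^ r - 1) div 2)"
proof -
  let ?q = "CARD('p) ^ r" and ?F = "fibp (CARD('p) ^ r) :: 'p mod_ring poly"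
  let ?D = "poly_X ^ 2 + 4 :: 'p mod_ring poly" and ?h = "(CARD('p) ^ r - 1) div 2"
  have q: "odd ?q" using assms by simp
  have D: "?D \<noteq> 0" using discriminant_monic(1)[where 'a="'p mod_ring"] by (metis degree_0 zero_neq_numeral)
  have frob: "(a + b) ^ ?q = a ^ ?q + b ^ ?q" for a b :: "'p mod_ring poly" by simp
  \<comment> \<open>The constant 4 is fixed by Frobenius, being a sum of ones.\<close>
  have "(4 :: 'p mod_ring poly) ^ ?q = (1 + 1 + 1 + 1) ^ ?q" by simp
  also have "\<dots> = 1 + 1 + 1 + 1" by (simp only: frob power_one)
  finally have 4: "(4 :: 'p mod_ring poly) ^ ?q = 4" by simp
  have "?D * ?F ^ 2 = lucas_at poly_X ?q ^ 2 - 4 * (-1) ^ ?q"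
    using lucas_fib_norm[of "poly_X :: 'p mod_ring poly" ?q] by (simp only: algebra_simps)
  also have "\<dots> = (poly_X ^ ?q) ^ 2 + 4" using q by (simp add: lucas_frobenius)
  also have "\<dots> = ?D ^ ?q" by (simp only: frob 4 power_mult[symmetric] mult.commute[of ?q 2])
  also have "\<dots> = ?D * (?D ^ ?h) ^ 2"
  proof -
    have "?q = Suc (?h * 2)" using q by (auto elim: oddE)
    then have "?D ^ ?q = ?D ^ Suc (?h * 2)" by simp
    then show ?thesis by (simp only: power_Suc power_mult)
  qed
  finally have "?F ^ 2 = (?D ^ ?h) ^ 2" using D by (simp only: mult_cancel_left simp_thms)
  then have "?F = ?D ^ ?h \<or> ?F = - (?D ^ ?h)" by (simp only: power2_eq_iff)
  moreover have "?F \<noteq> - (?D ^ ?h)"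
  proof
    assume *: "?F = - (?D ^ ?h)"
    have "lead_coeff ?F = 1" using monic_fibp[of ?q, where 'a="'p mod_ring"] prime_gt_0_nat[OF prime_CARD[where 'p='p]] by simp
    moreover have "lead_coeff (?D ^ ?h) = 1" by (simp only: lead_coeff_power discriminant_monic(2) power_one)
    ultimately have "(1 :: 'p mod_ring) = - 1" using * by (simp only: lead_coeff_minus)
    then have "(of_nat 2 :: 'p mod_ring) = 0" by (simp add: eq_neg_iff_add_eq_0)
    then have "CARD('p) dvd 2" by (rule of_nat_0_mod_ring_dvd)
    then have "CARD('p) = 2" by (rule primes_dvd_imp_eq[OF prime_CARD two_is_prime_nat])
    with assms show False by simp
  qed
  ultimately show ?thesis by simp
qed

section \<open>Indices that are powers of 2 in characteristic 2\<close>

lemma two_eq_0_char_2: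
  assumes "CARD('p::prime_card) = 2"
  shows "(2 :: 'p mod_ring poly) = 0"
  using of_nat_mod_ring_poly_eq_0_iff[of 2, where 'p='p] assms by simp

lemma lucas_char_2:
  assumes "CARD('p::prime_card) = 2"
  shows "lucas_at x n = (x * fib_at x n :: 'p mod_ring poly)"
proof -
  have "2 * (fib_at x (Suc n) - x * fib_at x n) = 0" using two_eq_0_char_2[OF assms] by simp
  then show ?thesis by (simp add: lucas_at_def algebra_simps)
qed

lemma fibp_prime_power_two:
  assumes "CARD('p::prime_card) = 2"
  shows "(fibp (2 ^ r) :: 'p mod_ring poly) = poly_X ^ (2 ^ r - 1)"
proof -
  have "poly_X * fibp (2 ^ r) = (poly_X ^ 2 ^ r :: 'p mod_ring poly)"
    using lucas_frobenius[of r, where 'p='p] by (simp add: assms lucas_char_2[OF assms])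
  also have "\<dots> = poly_X * poly_X ^ (2 ^ r - 1)"
    by (simp flip: power_Suc)
  finally show ?thesis by (simp add: poly_X_nonzero)
qed

section \<open>Reduction of the fibotomic polynomials modulo \<open>p\<close>\<close>

text \<open>The reduction of the integer polynomial. It is not defined through ranks modulo
  \<open>p\<close>; the ranks of its factors have to be determined separately.\<close>

definition fibotomic_mod :: "nat \<Rightarrow> 'p::prime_card mod_ring poly" where
  "fibotomic_mod n = map_poly of_int (fibotomic n)"

lemma map_poly_fibp: "map_poly of_int (fibp n) = (fibp n :: 'p::prime_card mod_ring poly)"
proof -
  have X: "map_poly of_int poly_X = (poly_X :: 'p mod_ring poly)" by (simp add: poly_X_def)
  show ?thesis
    by (induction "poly_X :: int poly" n rule: fib_at.induct)
      (simp_all add: of_int_poly_hom.hom_add of_int_poly_hom.hom_mult X)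
qed

lemma prod_fibotomic_mod:
  assumes "n > 0"
  shows "(fibp n :: 'p::prime_card mod_ring poly) = (\<Prod>d | d dvd n. fibotomic_mod d)"
proof -
  have "(fibp n :: 'p mod_ring poly) = map_poly of_int (\<Prod>d | d dvd n. fibotomic d)"
    using prod_fibotomic[OF assms] map_poly_fibp by metis
  then show ?thesis by (simp add: of_int_poly_hom.hom_prod fibotomic_mod_def)
qed

lemma degree_monic_fibotomic_mod:
  assumes "n > 0"
  shows "degree (fibotomic_mod n :: 'p::prime_card mod_ring poly) = degree (fibotomic n)"
    and "lead_coeff (fibotomic_mod n :: 'p mod_ring poly) = 1"
proof -
  have c: "coeff (fibotomic_mod n :: 'p mod_ring poly) (degree (fibotomic n)) = 1"
    using monic_fibotomic[OF assms] by (simp add: fibotomic_mod_def)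
  show *: "degree (fibotomic_mod n :: 'p mod_ring poly) = degree (fibotomic n)"
  proof (rule antisym)
    show "degree (fibotomic_mod n :: 'p mod_ring poly) \<le> degree (fibotomic n)"
      by (simp add: fibotomic_mod_def degree_map_poly_le)
    show "degree (fibotomic n) \<le> degree (fibotomic_mod n :: 'p mod_ring poly)"
      by (rule le_degree) (simp add: c)
  qed
  show "lead_coeff (fibotomic_mod n :: 'p mod_ring poly) = 1" using c by (simp only: *)
qed

lemma monic_fibotomic_mod: "n > 0 \<Longrightarrow> lead_coeff (fibotomic_mod n :: 'p::prime_card mod_ring poly) = 1"
  by (rule degree_monic_fibotomic_mod)

lemma fibotomic_mod_nonzero: "n > 0 \<Longrightarrow> (fibotomic_mod n :: 'p::prime_card mod_ring poly) \<noteq> 0"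
  using monic_fibotomic_mod[of n, where 'p='p] by auto

lemma degree_fibotomic_mod:
  "n \<ge> 2 \<Longrightarrow> degree (fibotomic_mod n :: 'p::prime_card mod_ring poly) = totient n"
  by (simp add: degree_monic_fibotomic_mod degree_fibotomic)

lemma fibotomic_mod_1: "fibotomic_mod (Suc 0) = (1 :: 'p::prime_card mod_ring poly)"
  by (simp add: fibotomic_mod_def fibotomic_1)

lemma fibotomic_mod_2: "fibotomic_mod 2 = (poly_X :: 'p::prime_card mod_ring poly)"
proof -
  have "d dvd 2 \<longleftrightarrow> d = 1 \<or> d = 2" for d :: nat
    using two_is_prime_nat by (metis dvd_refl one_dvd prime_nat_iff)
  then have "{d. d dvd 2} = {1, 2::nat}" by auto
  then show ?thesis using prod_fibotomic_mod[of 2, where 'p='p] by (simp add: fib_at_2 fibotomic_mod_1)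
qed

section \<open>Splitting off the p-part of the index\<close>

lemma divisors_prime_power_Suc:
  fixes p k m :: nat
  assumes "prime p" "coprime p m" "m > 0"
  shows "{d. d dvd p ^ Suc k * m} = {d. d dvd p ^ k * m} \<union> (\<lambda>d. p ^ Suc k * d) ` {d. d dvd m}"
    and "{d. d dvd p ^ k * m} \<inter> (\<lambda>d. p ^ Suc k * d) ` {d. d dvd m} = {}"
proof -
  have 1: "e \<in> (\<lambda>d. p ^ Suc k * d) ` {d. d dvd m}" if e: "e dvd p ^ Suc k * m" "\<not> e dvd p ^ k * m" for e
  proof -
    obtain a b where ab: "e = a * b" "a dvd p ^ Suc k" "b dvd m" using division_decomp[OF e(1)] by blast
    then obtain j where j: "j \<le> Suc k" "a = p ^ j" using divides_primepow_nat[OF assms(1)] by blast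
    have "j = Suc k"
    proof (rule ccontr)
      assume "j \<noteq> Suc k"
      then have "a dvd p ^ k" using j by (simp add: le_imp_power_dvd)
      then have "e dvd p ^ k * m" unfolding ab(1) using ab(3) by (rule mult_dvd_mono)
      with e(2) show False by simp
    qed
    then show ?thesis using ab j by auto
  qed
  have 2: "p ^ Suc k * d dvd p ^ Suc k * m" if "d dvd m" for d using that by (rule mult_dvd_mono[OF dvd_refl])
  have 3: "d dvd p ^ Suc k * m" if "d dvd p ^ k * m" for d
    using that by (rule dvd_trans) (intro mult_dvd_mono le_imp_power_dvd, simp_all)
  show "{d. d dvd p ^ Suc k * m} = {d. d dvd p ^ k * m} \<union> (\<lambda>d. p ^ Suc k * d) ` {d. d dvd m}"
  proof (intro equalityI subsetI)
    fix e assume "e \<in> {d. d dvd p ^ Suc k * m}"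
    then show "e \<in> {d. d dvd p ^ k * m} \<union> (\<lambda>d. p ^ Suc k * d) ` {d. d dvd m}"
      using 1[of e] by (cases "e dvd p ^ k * m") (simp_all only: mem_Collect_eq Un_iff simp_thms)
  next
    fix e assume "e \<in> {d. d dvd p ^ k * m} \<union> (\<lambda>d. p ^ Suc k * d) ` {d. d dvd m}"
    then show "e \<in> {d. d dvd p ^ Suc k * m}"
      using 2 3 by (elim UnE imageE) (simp_all only: mem_Collect_eq)
  qed
  have disj: False if "p ^ Suc k * d dvd p ^ k * m" for d
  proof -
    have "p ^ k * (p * d) dvd p ^ k * m" using that by (simp only: power_Suc mult_ac)
    then have "p * d dvd m" using assms(1) by (simp add: prime_gt_0_nat)
    then have "p dvd m" by (rule dvd_mult_left)
    with assms show False by (metis coprime_absorb_left not_prime_unit)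
  qed
  show "{d. d dvd p ^ k * m} \<inter> (\<lambda>d. p ^ Suc k * d) ` {d. d dvd m} = {}"
  proof (rule equals0I)
    fix e assume "e \<in> {d. d dvd p ^ k * m} \<inter> (\<lambda>d. p ^ Suc k * d) ` {d. d dvd m}"
    then show False using disj by (elim IntE imageE) (simp only: mem_Collect_eq)
  qed
qed

text \<open>The left side is \<open>F (p^(k+1) m) / F (p^k m)\<close>. Frobenius turns the quotient
  into \<open>F (p^(k+1)) / F (p^k)\<close> times a power of \<open>F m\<close> whose exponent is
  \<open>p^(k+1) - p^k\<close>, a totient.\<close>

lemma prod_fibotomic_mod_prime_power:
  fixes m k :: nat
  assumes "coprime CARD('p::prime_card) m" "m > 0"
  shows "(\<Prod>d | d dvd m. fibotomic_mod (CARD('p) ^ Suc k * d))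
    = fibotomic_mod (CARD('p) ^ Suc k) * (fibp m :: 'p mod_ring poly) ^ totient (CARD('p) ^ Suc k)"
proof -
  let ?p = "CARD('p)"
  have p: "?p > 0" "prime ?p" using prime_CARD[where 'p='p] prime_gt_0_nat by auto
  define G :: "nat \<Rightarrow> 'p mod_ring poly" where "G n = (\<Prod>d | d dvd n. fibotomic_mod (?p ^ Suc k * d))" for n
  have step: "fibp (?p ^ Suc k * n) = fibp (?p ^ k * n) * G n" if n: "coprime ?p n" "n > 0" for n
  proof -
    have inj: "inj_on (\<lambda>d. ?p ^ Suc k * d) {d. d dvd n}" using p by (auto simp: inj_on_def)
    have "(fibp (?p ^ Suc k * n) :: 'p mod_ring poly)
        = prod fibotomic_mod ({d. d dvd ?p ^ k * n} \<union> (\<lambda>d. ?p ^ Suc k * d) ` {d. d dvd n})"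
      using n p by (simp only: prod_fibotomic_mod divisors_prime_power_Suc(1)[OF p(2) n]
        zero_less_power nat_0_less_mult_iff simp_thms)
    also have "\<dots> = prod fibotomic_mod {d. d dvd ?p ^ k * n}
        * prod fibotomic_mod ((\<lambda>d. ?p ^ Suc k * d) ` {d. d dvd n})"
      using n p divisors_prime_power_Suc(2)[OF p(2) n] by (intro prod.union_disjoint) auto
    also have "prod fibotomic_mod ((\<lambda>d. ?p ^ Suc k * d) ` {d. d dvd n}) = G n"
      unfolding G_def by (simp only: prod.reindex[OF inj] o_def)
    finally show ?thesis using n p by (simp add: prod_fibotomic_mod)
  qed
  have "G 1 = fibotomic_mod (?p ^ Suc k)" by (simp add: G_def)
  then have F1: "(fibp (?p ^ Suc k) :: 'p mod_ring poly) = fibp (?p ^ k) * fibotomic_mod (?p ^ Suc k)"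
    using step[of 1] by simp
  have tot: "?p ^ Suc k = ?p ^ k + totient (?p ^ Suc k)"
  proof -
    have "?p ^ Suc k = ?p ^ k * (1 + (?p - 1))" using p by simp
    then show ?thesis unfolding totient_prime_power_Suc[OF p(2)] by (simp only: distrib_left mult_1_right)
  qed
  have "fibp (?p ^ k * m) * G m = fibp (?p ^ Suc k * m)" using step[OF assms] by simp
  also have "\<dots> = fibp (?p ^ Suc k) * fibp m ^ (?p ^ k + totient (?p ^ Suc k))"
    by (simp only: fibp_frobenius tot[symmetric])
  also have "\<dots> = (fibp (?p ^ k) * fibp m ^ ?p ^ k)
      * (fibotomic_mod (?p ^ Suc k) * fibp m ^ totient (?p ^ Suc k))"
    unfolding F1 power_add by (simp only: mult_ac)
  also have "fibp (?p ^ k) * fibp m ^ ?p ^ k = (fibp (?p ^ k * m) :: 'p mod_ring poly)"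
    by (simp only: fibp_frobenius)
  finally have "G m = fibotomic_mod (?p ^ Suc k) * fibp m ^ totient (?p ^ Suc k)"
    using fibp_nonzero[of "?p ^ k * m", where 'a="'p mod_ring"] assms(2) p by simp
  then show ?thesis by (simp only: G_def)
qed

text \<open>Induction on \<open>m\<close>: in the preceding product formula the proper divisors
  other than 1 cancel by the induction hypothesis, leaving the factor for \<open>m\<close>.\<close>

lemma fibotomic_mod_prime_power_mult:
  assumes "coprime CARD('p::prime_card) m" "m \<ge> 2"
  shows "(fibotomic_mod (CARD('p) ^ k * m) :: 'p mod_ring poly) = fibotomic_mod m ^ totient (CARD('p) ^ k)"
proof (cases k)
  case 0
  then show ?thesis by simp
next
  case (Suc j)
  let ?q = "CARD('p) ^ Suc j"
  have "(fibotomic_mod (?q * m) :: 'p mod_ring poly) = fibotomic_mod m ^ totient ?q"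
    using assms
  proof (induction m rule: less_induct)
    case (less m)
    \<comment> \<open>The divisor 1 is kept apart: the power relation fails there, and its factor
      \<open>fibotomic_mod ?q\<close> cancels directly.\<close>
    let ?P = "{d. d dvd m} - {1, m}"
    have fin: "finite {d. d dvd m}" using less.prems by simp
    have split: "{d. d dvd m} = insert 1 (insert m ?P)" by auto
    have m1: "1 \<noteq> m" using less.prems by simp
    have P: "d \<ge> 2 \<and> d < m \<and> coprime CARD('p) d" if "d \<in> ?P" for d
    proof -
      have "d dvd m" "d \<noteq> 1" "d \<noteq> m" using that by auto
      moreover from this have "d \<noteq> 0" "d \<le> m" using less.prems dvd_imp_le[of d m] by auto
      moreover have "coprime CARD('p) d" using less.prems(1) \<open>d dvd m\<close> by (rule algebraic_semidom_class.coprime_divisors[OF dvd_refl, rotated])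
      ultimately show ?thesis by auto
    qed
    have IH: "fibotomic_mod (?q * d) = (fibotomic_mod d ^ totient ?q :: 'p mod_ring poly)" if "d \<in> ?P" for d
      using P[OF that] by (intro less.IH) auto
    let ?R = "(\<Prod>d\<in>?P. fibotomic_mod d) :: 'p mod_ring poly"
    have finP: "finite ?P" using fin by simp
    have nz: "fibotomic_mod d \<noteq> (0 :: 'p mod_ring poly)" if "d \<in> ?P" for d
      using P[OF that] by (intro fibotomic_mod_nonzero) auto
    have "?R \<noteq> 0" unfolding prod_zero_iff[OF finP] using nz by blast
    have "fibotomic_mod ?q * (fibotomic_mod (?q * m) * ?R ^ totient ?q)
        = (\<Prod>d | d dvd m. fibotomic_mod (?q * d) :: 'p mod_ring poly)"
    proof -
      have "(\<Prod>d\<in>?P. fibotomic_mod (?q * d) :: 'p mod_ring poly) = ?R ^ totient ?q"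
        by (simp only: IH prod_power_distrib cong: prod.cong)
      moreover have "(\<Prod>d | d dvd m. fibotomic_mod (?q * d) :: 'p mod_ring poly)
          = fibotomic_mod (?q * 1) * (fibotomic_mod (?q * m) * (\<Prod>d\<in>?P. fibotomic_mod (?q * d)))"
        using fin m1 by (subst split) (subst prod.insert, simp, simp, subst prod.insert, simp_all)
      ultimately show ?thesis by simp
    qed
    also have "\<dots> = fibotomic_mod ?q * fibp m ^ totient ?q"
      using less.prems by (intro prod_fibotomic_mod_prime_power) auto
    also have "fibp m = fibotomic_mod m * ?R"
    proof -
      have "(fibp m :: 'p mod_ring poly) = (\<Prod>d | d dvd m. fibotomic_mod d)"
        using less.prems by (intro prod_fibotomic_mod) auto
      also have "\<dots> = fibotomic_mod 1 * (fibotomic_mod m * ?R)"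
        using fin m1 by (subst split) (subst prod.insert, simp, simp, subst prod.insert, simp_all)
      finally show ?thesis by (simp add: fibotomic_mod_1)
    qed
    finally have "fibotomic_mod (?q * m) * ?R ^ totient ?q = (fibotomic_mod m * ?R) ^ totient ?q"
      using fibotomic_mod_nonzero[of ?q, where 'p='p] prime_gt_0_nat[OF prime_CARD[where 'p='p]] by simp
    then show ?case using \<open>?R \<noteq> 0\<close> by (simp add: power_mult_distrib)
  qed
  then show ?thesis by (simp only: Suc)
qed

lemma fibotomic_mod_prime_power:
  "(fibp (CARD('p::prime_card) ^ Suc k) :: 'p mod_ring poly)
     = fibp (CARD('p) ^ k) * fibotomic_mod (CARD('p) ^ Suc k)"
proof -
  have p: "prime CARD('p)" "CARD('p) > 0" using prime_CARD[where 'p='p] prime_gt_0_nat by auto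
  have "{d. d dvd CARD('p) ^ Suc k} = insert (CARD('p) ^ Suc k) {d. d dvd CARD('p) ^ k}"
    using divisors_prime_power_Suc(1)[OF p(1), of 1 k] by simp
  moreover have "CARD('p) ^ Suc k \<notin> {d. d dvd CARD('p) ^ k}"
    using divisors_prime_power_Suc(2)[OF p(1), of 1 k] by simp
  ultimately show ?thesis using p by (simp add: prod_fibotomic_mod mult.commute del: power_Suc)
qed

section \<open>Degrees of the irreducible factors modulo \<open>p\<close>\<close>

lemma irreducible_not_dvd_of_nat:
  fixes f :: "'p::prime_card mod_ring poly"
  assumes "irreducible f" "\<not> CARD('p) dvd n"
  shows "\<not> f dvd of_nat n"
proof
  assume "f dvd of_nat n"
  have "(of_nat n :: 'p mod_ring) \<noteq> 0" using assms(2) of_nat_0_mod_ring_dvd[of n, where 'a='p] by auto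
  then have "is_unit [:of_nat n :: 'p mod_ring:]" by (simp add: is_unit_const_poly_iff dvd_field_iff)
  then have "is_unit (of_nat n :: 'p mod_ring poly)" by (simp add: of_nat_poly)
  with \<open>f dvd of_nat n\<close> have "is_unit f" by (rule dvd_unit_imp_unit)
  with assms(1) show False by (rule irreducible_not_unit[rotated, THEN notE])
qed

lemma irreducible_not_dvd_of_nat_4_mult:
  fixes f :: "'p::prime_card mod_ring poly"
  assumes "odd CARD('p)" "coprime CARD('p) m" "irreducible f"
  shows "\<not> f dvd of_nat (4 * m)"
proof (rule irreducible_not_dvd_of_nat[OF assms(3)])
  have "coprime CARD('p) 4"
    using assms(1) coprime_power_right_iff[of "CARD('p)" 2 2] by simp
  then have "coprime CARD('p) (4 * m)" using assms(2) by simp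
  then show "\<not> CARD('p) dvd 4 * m"
    using prime_CARD[where 'p='p] by (metis algebraic_semidom_class.coprime_absorb_left not_prime_unit)
qed

text \<open>An irreducible \<open>f\<close> divides \<open>x^(p^d) - x\<close> for
  \<open>d = degree f\<close> and for no smaller positive \<open>d\<close>. The last hypothesis
  gives \<delta> \<le> \<open>degree f\<close>, the third one excludes inequality.\<close>

lemma degree_irreducible_mod_ring_eqI:
  fixes f :: "'p::prime_card mod_ring poly"
  assumes f: "irreducible f" and "\<delta> > 0"
    and "f dvd poly_X ^ (CARD('p) ^ \<delta>) - poly_X"
    and "\<And>e. e > 0 \<Longrightarrow> f dvd poly_X ^ (CARD('p) ^ e) - poly_X \<Longrightarrow> \<delta> dvd e"
  shows "degree f = \<delta>"
proof (rule antisym)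
  have X: "monom 1 1 = (poly_X :: 'p mod_ring poly)" by (simp add: poly_X_def monom_altdef)
  have deg: "degree f > 0"
    using f is_unit_iff_degree[of f] irreducible_not_unit[of f] by (auto simp: irreducible_def)
  have "f dvd poly_X ^ (CARD('p) ^ degree f) - poly_X"
    using degree_divisor(1)[OF f refl] by (simp only: X)
  then have "\<delta> dvd degree f" using assms(4) deg by simp
  then show "\<delta> \<le> degree f" using deg by (rule dvd_imp_le)
  show "degree f \<le> \<delta>"
  proof (rule ccontr)
    assume "\<not> degree f \<le> \<delta>"
    then have "1 \<le> \<delta>" "\<delta> < degree f" using assms(2) by auto
    then have "\<not> f dvd poly_X ^ (CARD('p) ^ \<delta>) - poly_X"
      by (rule degree_divisor(2)[OF f refl, unfolded X])
    with assms(3) show False by simp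
  qed
qed

text \<open>Both sides say that \<open>2 n\<close> is an odd multiple of \<open>m\<close>.\<close>

lemma dvd_and_double_dvd_iff_cong:
  fixes m n :: nat
  assumes "m > 0"
  shows "m dvd 2 * n \<and> \<not> m dvd n \<longleftrightarrow> int (2 * m) dvd int (2 * n) - int m"
proof
  assume "m dvd 2 * n \<and> \<not> m dvd n"
  then obtain c where c: "2 * n = m * c" "\<not> m dvd n" by auto
  have "odd c"
  proof
    assume "even c"
    then obtain k where "c = 2 * k" by (elim evenE)
    with c show False by simp
  qed
  then obtain k where "c = 2 * k + 1" by (elim oddE)
  with c(1) have "2 * n = m + 2 * m * k" by simp
  then have "int (2 * n) = int (m + 2 * m * k)" by (rule arg_cong)
  then have "int (2 * n) - int m = int (2 * m) * int k" by simp
  then show "int (2 * m) dvd int (2 * n) - int m" by simp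
next
  assume "int (2 * m) dvd int (2 * n) - int m"
  then obtain t where "int (2 * n) - int m = int (2 * m) * t" by (elim dvdE)
  then have t: "2 * int n = int m * (2 * t + 1)" by (simp add: algebra_simps)
  then have "int m dvd int (2 * n)" by simp
  then have "m dvd 2 * n" by (simp only: int_dvd_int_iff)
  moreover have "\<not> m dvd n"
  proof
    assume "m dvd n"
    then obtain s where "n = m * s" by (elim dvdE)
    with t have "int m * (2 * int s) = int m * (2 * t + 1)" by simp
    with assms have "2 * int s = 2 * t + 1" by (simp only: mult_cancel_left) simp
    then show False by presburger
  qed
  ultimately show "m dvd 2 * n \<and> \<not> m dvd n" by simp
qed

section \<open>Odd p: divisibility of x^q - x as a congruence for q\<close>

context
  fixes f :: "'p::prime_card mod_ring poly" and m :: nat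
  assumes odd: "odd CARD('p)" and cop: "coprime CARD('p) m" and m3: "m \<ge> 3"
    and irr: "irreducible f" and rank: "has_rank poly_X f m"
begin

private lemma prime_f: "prime_elem f"
  using irr by (rule irreducible_imp_prime_elem)

private lemma not_dvd_4: "\<not> f dvd of_nat (4 * m)"
  by (rule irreducible_not_dvd_of_nat_4_mult[OF odd cop irr])

private lemma not_dvd_discriminant: "\<not> f dvd poly_X ^ 2 + 4"
proof
  assume "f dvd poly_X ^ 2 + 4"
  then have "f dvd (poly_X ^ 2 + 4) * pderiv (fibp m)" by (rule dvd_mult2)
  moreover have "f dvd fibp m" using rank by (simp add: has_rank_def)
  ultimately show False using prime_elem_not_dvd_pderiv_fibp[OF prime_f _ not_dvd_4] by simp
qed

text \<open>From \<open>F (2 n) = F n * L n\<close>: the norm identity shows that \<open>f\<close>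
  divides at most one of the two factors, since otherwise it would divide 4.\<close>

private lemma dvd_lucas_iff: "f dvd lucas_at poly_X n \<longleftrightarrow> m dvd 2 * n \<and> \<not> m dvd n"
proof -
  have F: "f dvd fibp k \<longleftrightarrow> m dvd k" for k by (rule has_rank_dvd_iff[OF prime_f rank])
  have "\<not> (f dvd lucas_at poly_X n \<and> f dvd fibp n)"
  proof
    assume "f dvd lucas_at poly_X n \<and> f dvd fibp n"
    then have "f dvd lucas_at poly_X n ^ 2 - (poly_X ^ 2 + 4) * fibp n ^ 2"
      by (intro dvd_diff dvd_mult) (auto simp: power2_eq_square)
    then have "f dvd 4" by (simp only: lucas_fib_norm) (simp add: minus_one_power_iff split: if_splits)
    then have "f dvd of_nat (4 * m)" by (simp add: dvd_mult2)
    with not_dvd_4 show False by simp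
  qed
  moreover have "m dvd 2 * n \<longleftrightarrow> f dvd fibp n \<or> f dvd lucas_at poly_X n"
    using F[of "2 * n"] prime_elem_dvd_mult_iff[OF prime_f] by (simp only: fib_at_double)
  ultimately show ?thesis using F[of n] by satx
qed

text \<open>With \<open>q = 2 a + 1\<close>, the factorization of \<open>L q - x\<close> gives rank
  conditions on \<open>a\<close> and \<open>a + 1\<close>. Since \<open>2 a = q - 1\<close> and
  \<open>2 (a + 1) = q + 1\<close>, doubling makes them congruences for \<open>q\<close> modulo
  \<open>2 m\<close>.\<close>

lemma dvd_frobenius_iff_odd:
  "f dvd poly_X ^ (CARD('p) ^ e) - poly_X \<longleftrightarrow> frobenius_cong CARD('p) m e"
proof -
  let ?q = "CARD('p) ^ e"
  have "odd ?q" using odd by simp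
  then obtain a where q: "?q = 2 * a + 1" by (elim oddE)
  have L: "poly_X ^ ?q - poly_X = lucas_at poly_X (Suc (2 * a)) - (poly_X :: 'p mod_ring poly)"
    using lucas_frobenius[of e, where 'p='p] q by simp
  have F: "f dvd fibp k \<longleftrightarrow> m dvd k" for k by (rule has_rank_dvd_iff[OF prime_f rank])
  have two: "m dvd k \<longleftrightarrow> int (2 * m) dvd int (2 * k)" for k
    by (simp only: int_dvd_int_iff) simp
  show ?thesis
  proof (cases "even a")
    case True
    then have q4: "?q mod 4 = 1" unfolding q by presburger
    have "f dvd poly_X ^ ?q - poly_X \<longleftrightarrow> m dvd a \<or> m dvd Suc a"
      unfolding L lucas_at_minus_even[OF True]
      using not_dvd_discriminant F by (simp only: prime_elem_dvd_mult_iff[OF prime_f] simp_thms)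
    also have "\<dots> \<longleftrightarrow> int (2 * m) dvd int ?q - 1 \<or> int (2 * m) dvd int ?q - (-1)"
      unfolding two q by (simp add: algebra_simps)
    also have "\<dots> \<longleftrightarrow> frobenius_cong CARD('p) m e"
      unfolding frobenius_cong_def by (simp only: q4 if_True cong_iff_dvd_diff simp_thms)
    finally show ?thesis .
  next
    case False
    then have q4: "?q mod 4 \<noteq> 1" unfolding q by presburger
    have "f dvd poly_X ^ ?q - poly_X \<longleftrightarrow>
        (m dvd 2 * a \<and> \<not> m dvd a) \<or> (m dvd 2 * Suc a \<and> \<not> m dvd Suc a)"
      unfolding L lucas_at_minus_odd[OF False]
      by (simp only: prime_elem_dvd_mult_iff[OF prime_f] dvd_lucas_iff)
    also have "\<dots> \<longleftrightarrow> int (2 * m) dvd int ?q - (int m + 1) \<or> int (2 * m) dvd int ?q - (int m - 1)"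
    proof -
      have "m > 0" using m3 by simp
      moreover have "int ?q - (int m + 1) = int (2 * a) - int m" "int ?q - (int m - 1) = int (2 * Suc a) - int m"
        unfolding q by simp_all
      ultimately show ?thesis by (simp only: dvd_and_double_dvd_iff_cong)
    qed
    also have "\<dots> \<longleftrightarrow> frobenius_cong CARD('p) m e"
      unfolding frobenius_cong_def using q4 by (simp only: if_False cong_iff_dvd_diff)
    finally show ?thesis .
  qed
qed

lemma degree_eq_delta_odd: "degree f = delta_odd CARD('p) m"
proof (rule degree_irreducible_mod_ring_eqI[OF irr])
  show "delta_odd CARD('p) m > 0" by (rule delta_odd_pos[OF odd m3 cop])
  show "f dvd poly_X ^ (CARD('p) ^ delta_odd CARD('p) m) - poly_X"
    unfolding dvd_frobenius_iff_odd by (rule frobenius_cong_delta_odd[OF odd m3 cop])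
  show "delta_odd CARD('p) m dvd e" if "f dvd poly_X ^ (CARD('p) ^ e) - poly_X" for e
    using that unfolding dvd_frobenius_iff_odd by (rule frobenius_cong_imp_delta_odd_dvd[OF odd m3 cop])
qed

end

text \<open>Here \<open>x * F q = L q = x^q\<close>. Multiplying Cassini's identity
  \<open>F (q+1) * F (q-1) = F q ^ 2 + 1\<close> by \<open>x^2\<close> gives
  \<open>(x^q - x)^2\<close> on the right. The factor \<open>x = F 2\<close> is not divisible by
  \<open>f\<close>, whose rank is at least 3.\<close>

lemma dvd_frobenius_iff_two:
  fixes f :: "'p::prime_card mod_ring poly" and m :: nat
  assumes p2: "CARD('p) = 2" and m: "m \<ge> 3" and irr: "irreducible f" and rank: "has_rank poly_X f m"
    and e: "e > 0"
  shows "f dvd poly_X ^ (2 ^ e) - poly_X \<longleftrightarrow>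
    [int (2 ^ e) = 1] (mod int m) \<or> [int (2 ^ e) = -1] (mod int m)"
proof -
  let ?q = "2 ^ e :: nat" and ?X = "poly_X :: 'p mod_ring poly"
  have prime: "prime_elem f" using irr by (rule irreducible_imp_prime_elem)
  have F: "f dvd fibp k \<longleftrightarrow> m dvd k" for k by (rule has_rank_dvd_iff[OF prime rank])
  have "\<not> m dvd 2" using m by (auto dest: dvd_imp_le)
  then have X: "\<not> f dvd poly_X" using F[of 2] by (simp only: fib_at_2 simp_thms)
  obtain n where n: "?q = Suc n" using gr0_implies_Suc[of ?q] by auto
  have "even ?q" using e by simp
  then have "odd n" using n by simp
  have 2: "(2 :: 'p mod_ring poly) = 0" by (rule two_eq_0_char_2[OF p2])
  have "fibp (Suc ?q) * fibp n = fibp ?q ^ 2 + (1 :: 'p mod_ring poly)"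
    using fib_at_cassini[of ?X n] \<open>odd n\<close> by (simp only: n) (simp add: algebra_simps)
  then have "?X ^ 2 * (fibp (Suc ?q) * fibp n) = (?X * fibp ?q) ^ 2 + ?X ^ 2"
    by (simp only: distrib_left power_mult_distrib mult_1_right)
  also have "?X * fibp ?q = ?X ^ ?q"
    using lucas_frobenius[of e, where 'p='p] lucas_char_2[OF p2, of ?X ?q] p2 by simp
  also have "(?X ^ ?q) ^ 2 + ?X ^ 2 = (?X ^ ?q - ?X) ^ 2 + 2 * (?X ^ ?q * ?X)"
    by (simp add: power2_eq_square algebra_simps)
  finally have sq: "(?X ^ ?q - ?X) ^ 2 = ?X ^ 2 * (fibp (Suc ?q) * fibp n)" by (simp add: 2)
  have "f dvd ?X ^ ?q - ?X \<longleftrightarrow> f dvd (?X ^ ?q - ?X) ^ 2"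
    by (simp only: power2_eq_square prime_elem_dvd_mult_iff[OF prime] simp_thms)
  also have "\<dots> \<longleftrightarrow> m dvd Suc ?q \<or> m dvd n"
    unfolding sq unfolding power2_eq_square using X F by (simp only: prime_elem_dvd_mult_iff[OF prime] simp_thms)
  also have "\<dots> \<longleftrightarrow> int m dvd int ?q - 1 \<or> int m dvd int ?q - (-1)"
  proof -
    have "int ?q - 1 = int n" "int ?q - (-1) = int (Suc ?q)" unfolding n by simp_all
    then show ?thesis by (simp only: int_dvd_int_iff) satx
  qed
  finally show ?thesis by (simp only: cong_iff_dvd_diff)
qed

lemma degree_eq_delta_two:
  fixes f :: "'p::prime_card mod_ring poly" and m :: nat
  assumes p2: "CARD('p) = 2" and m: "m \<ge> 3" "odd m" and irr: "irreducible f" and rank: "has_rank poly_X f m"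
  shows "degree f = delta_two m"
proof (rule degree_irreducible_mod_ring_eqI[OF irr])
  note iff = dvd_frobenius_iff_two[OF p2 m(1) irr rank] and delta = delta_two_properties[OF m(2,1)]
  show pos: "delta_two m > 0" by (rule delta)
  show "f dvd poly_X ^ (CARD('p) ^ delta_two m) - poly_X"
    unfolding p2 iff[OF pos] by (rule delta)
  show "delta_two m dvd e" if "e > 0" "f dvd poly_X ^ (CARD('p) ^ e) - poly_X" for e
    using that(2) unfolding p2 iff[OF that(1)] by (rule delta)
qed

section \<open>Factorization of the reduced fibotomic polynomials\<close>

text \<open>The two factors are disjoint subproducts of the product for \<open>F m\<close>. Hence a
  common divisor of them is a repeated factor of \<open>F m\<close>.\<close>

lemma fibotomic_mod_mult_fibp_dvd:
  assumes "r dvd m" "r \<noteq> m" "m > 0"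
  shows "fibotomic_mod m * fibp r dvd (fibp m :: 'p::prime_card mod_ring poly)"
proof -
  have r: "r > 0" using assms by (auto intro: Nat.gr0I)
  then have fin: "finite {d. d dvd r}" by simp
  have "m \<notin> {d. d dvd r}" using assms r by (auto dest: dvd_antisym)
  then have "fibotomic_mod m * fibp r = (\<Prod>d\<in>insert m {d. d dvd r}. fibotomic_mod d :: 'p mod_ring poly)"
    using fin r by (simp add: prod_fibotomic_mod)
  also have "\<dots> dvd (\<Prod>d | d dvd m. fibotomic_mod d)"
  proof (rule prod_dvd_prod_subset)
    show "finite {d. d dvd m}" using assms(3) by simp
    show "insert m {d. d dvd r} \<subseteq> {d. d dvd m}" using assms(1) by (auto intro: dvd_trans)
  qed
  finally show ?thesis using assms(3) by (simp add: prod_fibotomic_mod)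
qed

lemma fibotomic_mod_dvd_fibp:
  assumes "m > 0"
  shows "fibotomic_mod m dvd (fibp m :: 'p::prime_card mod_ring poly)"
  unfolding prod_fibotomic_mod[OF assms] using assms by (intro dvd_prodI) auto

section \<open>Odd p: squarefreeness and ranks\<close>

lemma fibp_mod_ring_squarefree_odd:
  fixes f :: "'p::prime_card mod_ring poly"
  assumes odd: "odd CARD('p)" and cop: "coprime CARD('p) m" and irr: "irreducible f"
  shows "\<not> f ^ 2 dvd fibp m"
proof
  assume sq: "f ^ 2 dvd fibp m"
  have "\<not> f dvd of_nat (4 * m)" by (rule irreducible_not_dvd_of_nat_4_mult[OF odd cop irr])
  moreover have "f dvd fibp m" using sq unfolding power2_eq_square by (rule dvd_mult_left)
  ultimately have "\<not> f dvd (poly_X ^ 2 + 4) * pderiv (fibp m)"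
    using prime_elem_not_dvd_pderiv_fibp[OF irreducible_imp_prime_elem[OF irr]] by simp
  moreover have "f dvd (poly_X ^ 2 + 4) * pderiv (fibp m)"
    using square_dvd_imp_dvd_pderiv[OF sq] by (rule dvd_mult)
  ultimately show False by simp
qed

text \<open>A rank \<open>r\<close> properly dividing \<open>m\<close> would make \<open>f\<close> a
  common factor of \<open>fibotomic_mod m\<close> and \<open>F r\<close>, hence a double factor of
  \<open>F m\<close>.\<close>

lemma has_rank_factor_odd:
  fixes f :: "'p::prime_card mod_ring poly"
  assumes odd: "odd CARD('p)" and cop: "coprime CARD('p) m" and m: "m > 0"
    and irr: "irreducible f" and f: "f dvd fibotomic_mod m"
  shows "has_rank poly_X f m"
proof -
  have "f dvd fibp m" using f fibotomic_mod_dvd_fibp[OF m] by (rule dvd_trans)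
  then obtain r where r: "has_rank poly_X f r" "r dvd m"
    using has_rank_exists[OF irreducible_imp_prime_elem[OF irr]] m by metis
  have "r = m"
  proof (rule ccontr)
    assume "r \<noteq> m"
    have "f dvd fibp r" using r(1) by (simp add: has_rank_def)
    with f have "f * f dvd fibotomic_mod m * fibp r" by (rule mult_dvd_mono)
    then have "f ^ 2 dvd fibp m"
      unfolding power2_eq_square using fibotomic_mod_mult_fibp_dvd[OF r(2) \<open>r \<noteq> m\<close> m] by (rule dvd_trans)
    with fibp_mod_ring_squarefree_odd[OF odd cop irr] show False by simp
  qed
  with r(1) show ?thesis by simp
qed

section \<open>Characteristic 2: squares of squarefree polynomials\<close>

lemma pderiv_fibp_char_2:
  assumes "CARD('p::prime_card) = 2"
  shows "poly_X * pderiv (fibp n) = (of_nat n - 1) * (fibp n :: 'p mod_ring poly)"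
proof -
  have 4: "(4 :: 'p mod_ring poly) = 0"
    using of_nat_mod_ring_poly_eq_0_iff[of 4, where 'p='p] assms by simp
  \<comment> \<open>In characteristic 2 the discriminant becomes \<open>x^2\<close> and
    \<open>L n = x * F n\<close>, so one factor x can be cancelled.\<close>
  have "poly_X * (poly_X * pderiv (fibp n)) = poly_X * ((of_nat n - 1) * (fibp n :: 'p mod_ring poly))"
    using pderiv_fibp[of n, where 'a="'p mod_ring"] unfolding lucas_char_2[OF assms] 4
    by (simp add: algebra_simps power2_eq_square)
  then show ?thesis using poly_X_nonzero[where 'a="'p mod_ring"] by (simp only: mult_cancel_left simp_thms)
qed

lemma fibp_odd_char_2:
  assumes "CARD('p::prime_card) = 2"
  shows "(fibp (Suc (2 * j)) :: 'p mod_ring poly) = (fibp (Suc j) + fibp j) ^ 2"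
proof -
  have "(fibp (Suc j) + fibp j) ^ 2 = fibp (Suc (2 * j)) + 2 * (fibp (Suc j) * fibp j :: 'p mod_ring poly)"
    unfolding fib_at_double_Suc by (simp add: power2_eq_square algebra_simps)
  then show ?thesis using two_eq_0_char_2[OF assms] by simp
qed

text \<open>A double factor would divide x times the derivative, which is \<open>F j\<close> up to
  sign for even \<open>j\<close> and \<open>F (j+1)\<close> for odd \<open>j\<close>. Together with
  the sum it would then divide both neighbours.\<close>

lemma fibp_odd_char_2_squarefree:
  fixes f :: "'p::prime_card mod_ring poly"
  assumes p2: "CARD('p) = 2" and irr: "irreducible f"
  shows "\<not> f ^ 2 dvd fibp (Suc j) + fibp j"
proof
  assume sq: "f ^ 2 dvd fibp (Suc j) + fibp j"
  let ?H = "fibp (Suc j) + fibp j :: 'p mod_ring poly"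
  have prime: "prime_elem f" using irr by (rule irreducible_imp_prime_elem)
  have H: "f dvd ?H" using sq unfolding power2_eq_square by (rule dvd_mult_left)
  have "f dvd poly_X * pderiv ?H" using square_dvd_imp_dvd_pderiv[OF sq] by (rule dvd_mult)
  also have "poly_X * pderiv ?H = of_nat j * fibp (Suc j) + (of_nat j - 1) * fibp j"
    by (simp only: pderiv_add distrib_left pderiv_fibp_char_2[OF p2]) simp
  finally have dvd: "f dvd of_nat j * fibp (Suc j) + (of_nat j - 1) * fibp j" .
  have "f dvd fibp (Suc j) \<or> f dvd fibp j"
  proof (cases "even j")
    case True
    then have "(of_nat j :: 'p mod_ring poly) = 0" by (simp add: of_nat_mod_ring_poly_eq_0_iff p2)
    with dvd show ?thesis by simp
  next
    case False
    then obtain k where "j = 2 * k + 1" by (elim oddE)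
    then have "(of_nat j :: 'p mod_ring poly) = 1"
      using two_eq_0_char_2[OF p2] by simp
    with dvd show ?thesis by simp
  qed
  then have "f dvd fibp (Suc j) \<and> f dvd fibp j"
    using H dvd_add_right_iff[of f "fibp (Suc j)" "fibp j"] dvd_add_left_iff[of f "fibp j" "fibp (Suc j)"] by metis
  with prime_elem_not_dvd_consecutive_fib[OF prime, of poly_X j] show False by simp
qed

lemma prod_of_squares:
  assumes "\<And>d. d \<in> S \<Longrightarrow> \<exists>T. g d = T ^ 2"
  shows "\<exists>A :: 'a::comm_semiring_1. (\<Prod>d\<in>S. g d) = A ^ 2"
proof -
  obtain T where "\<And>d. d \<in> S \<Longrightarrow> g d = T d ^ 2" using assms by metis
  then have "(\<Prod>d\<in>S. g d) = (\<Prod>d\<in>S. T d ^ 2)"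
    by (intro prod.cong refl)
  also have "\<dots> = (\<Prod>d\<in>S. T d) ^ 2" by (simp only: prod_power_distrib)
  finally show ?thesis ..
qed

text \<open>By induction the proper divisors contribute a square \<open>A^2\<close> to
  \<open>F m = H^2\<close>; so \<open>A\<close> divides \<open>H\<close>, and the remaining factor
  is the square of the quotient.\<close>

lemma fibotomic_mod_square_char_2:
  assumes p2: "CARD('p::prime_card) = 2"
  shows "odd m \<Longrightarrow> \<exists>T. (fibotomic_mod m :: 'p mod_ring poly) = T ^ 2"
proof (induction m rule: less_induct)
  case (less m)
  have m: "m > 0" using less.prems by (auto intro: Nat.gr0I)
  have fin: "finite {d. d dvd m}" using m by simp
  have "\<exists>T. (fibotomic_mod d :: 'p mod_ring poly) = T ^ 2" if "d \<in> {d. d dvd m} - {m}" for d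
  proof (rule less.IH)
    have "d dvd m" "d \<noteq> m" using that by auto
    then show "d < m" using m dvd_imp_le[of d m] by simp
    show "odd d" using \<open>d dvd m\<close> less.prems by (auto dest: dvd_trans)
  qed
  from prod_of_squares[OF this] obtain A :: "'p mod_ring poly" where A: "(\<Prod>d\<in>{d. d dvd m} - {m}. fibotomic_mod d) = A ^ 2" ..
  obtain j where j: "m = Suc (2 * j)" using less.prems by (auto elim: oddE)
  let ?H = "fibp (Suc j) + fibp j :: 'p mod_ring poly"
  have "?H ^ 2 = fibp m" unfolding j by (rule fibp_odd_char_2[OF p2, symmetric])
  also have "\<dots> = (\<Prod>d | d dvd m. fibotomic_mod d)" by (rule prod_fibotomic_mod[OF m])
  also have "\<dots> = fibotomic_mod m * A ^ 2"
    unfolding A[symmetric] using fin by (intro prod.remove) auto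
  finally have eq: "?H ^ 2 = fibotomic_mod m * A ^ 2" .
  then have "A ^ 2 dvd ?H ^ 2" by simp
  then have "A dvd ?H" by simp
  then obtain T where T: "?H = A * T" by (elim dvdE)
  have "fibp m \<noteq> (0 :: 'p mod_ring poly)" using m by (rule fibp_nonzero)
  then have "A \<noteq> 0" using eq \<open>?H ^ 2 = fibp m\<close> by auto
  moreover have "A ^ 2 * fibotomic_mod m = A ^ 2 * T ^ 2"
    using eq unfolding T by (simp only: power_mult_distrib mult.commute)
  ultimately have "fibotomic_mod m = T ^ 2" by simp
  then show ?case ..
qed

lemma monic_if_square_monic_char_2:
  fixes T :: "'p::prime_card mod_ring poly"
  assumes p2: "CARD('p) = 2" and "lead_coeff (T ^ 2) = 1"
  shows "lead_coeff T = 1"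
proof -
  have "(of_nat 2 :: 'p mod_ring) = 0" unfolding p2[symmetric] by simp
  then have "- 1 = (1 :: 'p mod_ring)" by (simp add: neg_eq_iff_add_eq_0)
  moreover have "lead_coeff T ^ 2 = 1" using assms(2) by (simp only: lead_coeff_power)
  ultimately show ?thesis by (metis power2_eq_1_iff)
qed

text \<open>\<open>F m\<close> is the square of a squarefree polynomial, so no fourth power of an
  irreducible divides it. A double factor of \<open>T\<close>, or a factor of rank below
  \<open>m\<close>, would produce one.\<close>

lemma sqrt_fibotomic_mod_char_2:
  fixes f T :: "'p::prime_card mod_ring poly"
  assumes p2: "CARD('p) = 2" and m: "odd m" and irr: "irreducible f"
    and T: "fibotomic_mod m = T ^ 2"
  shows "\<not> f ^ 2 dvd T" and "f dvd T \<Longrightarrow> has_rank poly_X f m"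
proof -
  have prime: "prime_elem f" using irr by (rule irreducible_imp_prime_elem)
  have m0: "m > 0" using m by (auto intro: Nat.gr0I)
  have not4: "\<not> (f ^ 2) ^ 2 dvd fibp m"
  proof
    obtain j where j: "m = Suc (2 * j)" using m by (auto elim: oddE)
    assume "(f ^ 2) ^ 2 dvd fibp m"
    then have "f ^ 2 dvd fibp (Suc j) + fibp j" unfolding j fibp_odd_char_2[OF p2] by (simp only: pow_divides_pow_iff zero_less_numeral)
    with fibp_odd_char_2_squarefree[OF p2 irr] show False by simp
  qed
  show "\<not> f ^ 2 dvd T"
  proof
    assume "f ^ 2 dvd T"
    then have "(f ^ 2) ^ 2 dvd fibotomic_mod m" unfolding T by (rule dvd_power_same)
    then have "(f ^ 2) ^ 2 dvd fibp m" using fibotomic_mod_dvd_fibp[OF m0] by (rule dvd_trans)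
    with not4 show False by simp
  qed
  assume "f dvd T"
  then have f2: "f ^ 2 dvd fibotomic_mod m" unfolding T by (rule dvd_power_same)
  then have "f ^ 2 dvd fibp m" using fibotomic_mod_dvd_fibp[OF m0] by (rule dvd_trans)
  then have "f dvd fibp m" unfolding power2_eq_square by (rule dvd_mult_left)
  then obtain r where r: "has_rank poly_X f r" "r dvd m"
    using has_rank_exists[OF prime] m0 by metis
  have "r = m"
  proof (rule ccontr)
    assume "r \<noteq> m"
    have "odd r" using r(2) m by (auto dest: dvd_trans)
    then obtain i where i: "r = Suc (2 * i)" by (auto elim: oddE)
    have "f dvd fibp r" using r(1) by (simp add: has_rank_def)
    \<comment> \<open>\<open>F r\<close> is a square as well, so \<open>f\<close> divides it at
      least twice.\<close>
    then have "f dvd fibp (Suc i) + fibp i"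
      unfolding i fibp_odd_char_2[OF p2] using prime by (rule prime_elem_dvd_power[rotated])
    then have "f ^ 2 dvd fibp r" unfolding i fibp_odd_char_2[OF p2] by (rule dvd_power_same)
    with f2 have "f ^ 2 * f ^ 2 dvd fibotomic_mod m * fibp r" by (rule mult_dvd_mono)
    then have "(f ^ 2) ^ 2 dvd fibotomic_mod m * fibp r" by (simp only: power2_eq_square)
    then have "(f ^ 2) ^ 2 dvd fibp m"
      using fibotomic_mod_mult_fibp_dvd[OF r(2) \<open>r \<noteq> m\<close> m0] by (rule dvd_trans)
    with not4 show False by simp
  qed
  with r(1) show "has_rank poly_X f m" by simp
qed

text \<open>\<open>S\<close> consists of the homogenized monic irreducible factors of
  \<open>Q\<close>; setting y = 1 shows that they stay distinct, and the degree counts them.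
  \<open>Q\<close> will be \<open>fibotomic_mod m\<close> for odd \<open>p\<close> and its square
  root for \<open>p = 2\<close>.\<close>

lemma homogeneous_factorization:
  fixes Q :: "'p::prime_card mod_ring poly"
  assumes monic: "lead_coeff Q = 1" and \<delta>: "\<delta> > 0"
    and sqfree: "\<And>f. irreducible f \<Longrightarrow> \<not> f ^ 2 dvd Q"
    and deg: "\<And>f. irreducible f \<Longrightarrow> f dvd Q \<Longrightarrow> degree f = \<delta>"
  shows "\<exists>S. finite S \<and> card S = degree Q div \<delta> \<and>
     (\<forall>f\<in>S. irreducible f \<and> homogeneous \<delta> f \<and> monic_in_x f) \<and>
     homogenize (degree Q * t) (Q ^ t) = (\<Prod>f\<in>S. f ^ t)"
proof -
  let ?S = "monic_irreducible_factors Q"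
  have fin: "finite ?S" and Q: "Q = \<Prod>?S"
    using squarefree_eq_prod_factors[OF monic sqfree] by auto
  have S: "irreducible f" "lead_coeff f = 1" "degree f = \<delta>" if "f \<in> ?S" for f
    using that deg[of f] by (auto simp: monic_irreducible_factors_def)
  have "degree Q = degree (\<Prod>f\<in>?S. f)" by (rule arg_cong[OF Q])
  also have "\<dots> = (\<Sum>f\<in>?S. degree f)"
    using S(1) by (intro degree_prod_eq_sum_degree) (auto simp: irreducible_def)
  also have "\<dots> = card ?S * \<delta>" using S(3) by simp
  finally have dQ: "degree Q = card ?S * \<delta>" .
  have inj: "inj_on (homogenize \<delta>) ?S"
    by (rule inj_on_inverseI[where g = dehomogenize]) (simp add: dehomogenize_homogenize S(3))
  let ?T = "homogenize \<delta> ` ?S"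
  have T: "\<forall>g\<in>?T. irreducible g \<and> homogeneous \<delta> g \<and> monic_in_x g"
  proof
    fix g assume "g \<in> ?T"
    then obtain f where f: "f \<in> ?S" "g = homogenize \<delta> f" by (elim imageE)
    have "irreducible (homogenize (degree f) f)"
      by (rule irreducible_homogenize[OF S(1)[OF f(1)] S(2)[OF f(1)]])
    moreover have "lead_coeff (homogenize (degree f) f) = 1"
      by (rule lead_coeff_homogenize_monic[OF S(2)[OF f(1)]])
    ultimately show "irreducible g \<and> homogeneous \<delta> g \<and> monic_in_x g" unfolding f(2) S(3)[OF f(1)] by (simp add: homogeneous_homogenize monic_in_x_def)
  qed
  have "homogenize (degree Q) Q = homogenize (\<Sum>f\<in>?S. \<delta>) (\<Prod>f\<in>?S. f)"
    unfolding sum_constant of_nat_id dQ[symmetric] by (rule arg_cong[OF Q])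
  also have "\<dots> = (\<Prod>f\<in>?S. homogenize \<delta> f)"
    using fin S(3) by (intro homogenize_prod(1)) simp_all
  also have "\<dots> = \<Prod>?T" using inj by (simp add: prod.reindex)
  finally have "homogenize (degree Q * t) (Q ^ t) = (\<Prod>g\<in>?T. g) ^ t"
    by (simp only: homogenize_power[OF order_refl])
  then have "homogenize (degree Q * t) (Q ^ t) = (\<Prod>g\<in>?T. g ^ t)" by (simp only: prod_power_distrib)
  moreover have "card ?T = degree Q div \<delta>" using \<delta> by (simp add: card_image[OF inj] dQ)
  moreover have "finite ?T" using fin by simp
  ultimately show ?thesis using T by blast
qed

section \<open>The prime power indices and the four cases\<close>

lemma reduce_mod_fibotomic_hom:
  "n \<ge> 2 \<Longrightarrow> (reduce_mod (fibotomic_hom n) :: 'p::prime_card mod_ring poly poly)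
     = homogenize (totient n) (fibotomic_mod n)"
  by (simp add: fibotomic_hom_def reduce_mod_homogenize fibotomic_mod_def)

text \<open>The quotient of \<open>F (p^(j+1))\<close> by \<open>F (p^j)\<close>, both powers of
  \<open>x^2 + 4\<close>; the exponents differ by half the totient.\<close>

lemma fibotomic_mod_prime_power_odd:
  assumes odd: "odd CARD('p::prime_card)"
  shows "(fibotomic_mod (CARD('p) ^ Suc j) :: 'p mod_ring poly)
    = (poly_X ^ 2 + 4) ^ (totient (CARD('p) ^ Suc j) div 2)"
proof -
  let ?p = "CARD('p)" and ?D = "poly_X ^ 2 + 4 :: 'p mod_ring poly"
  have "odd (?p ^ j)" using odd by simp
  then obtain a where a: "?p ^ j = 2 * a + 1" by (elim oddE)
  obtain b where b: "?p = 2 * b + 1" using odd by (elim oddE)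
  have tot: "totient (?p ^ Suc j) = 2 * (?p ^ j * b)"
    using totient_prime_power_Suc[OF prime_CARD[where 'p='p], of j] b by simp
  have "(?p ^ Suc j - 1) div 2 = (?p ^ j - 1) div 2 + ?p ^ j * b"
  proof -
    have "?p ^ Suc j = 2 * (a + ?p ^ j * b) + 1"
    proof -
      have "?p ^ Suc j = ?p ^ j * (2 * b + 1)" using b by simp
      also have "\<dots> = ?p ^ j + 2 * (?p ^ j * b)" by (simp add: algebra_simps)
      finally show ?thesis using a by simp
    qed
    then have "(?p ^ Suc j - 1) div 2 = a + ?p ^ j * b" by simp
    moreover have "(?p ^ j - 1) div 2 = a" using a by simp
    ultimately show ?thesis by (simp only:)
  qed
  then have "fibp (?p ^ Suc j) = fibp (?p ^ j) * ?D ^ (?p ^ j * b)"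
    unfolding fibp_prime_power_odd[OF odd] by (simp only: power_add)
  then have "fibp (?p ^ j) * fibotomic_mod (?p ^ Suc j) = fibp (?p ^ j) * ?D ^ (?p ^ j * b)"
    by (simp only: fibotomic_mod_prime_power)
  moreover have "fibp (?p ^ j) \<noteq> (0 :: 'p mod_ring poly)"
    using prime_gt_0_nat[OF prime_CARD[where 'p='p]] by (intro fibp_nonzero) simp
  ultimately have "fibotomic_mod (?p ^ Suc j) = ?D ^ (?p ^ j * b)"
    by (simp only: mult_cancel_left simp_thms)
  moreover have "totient (?p ^ Suc j) div 2 = ?p ^ j * b" unfolding tot by simp
  ultimately show ?thesis by (simp only:)
qed

text \<open>The same quotient for powers of x, with exponents \<open>2^(j+1) - 1\<close> and
  \<open>2^j - 1\<close>.\<close>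

lemma fibotomic_mod_prime_power_two:
  assumes "CARD('p::prime_card) = 2"
  shows "(fibotomic_mod (2 ^ Suc j) :: 'p mod_ring poly) = poly_X ^ (2 ^ j)"
proof -
  have "poly_X ^ (2 ^ j - 1) * fibotomic_mod (2 ^ Suc j) = (poly_X ^ (2 ^ Suc j - 1) :: 'p mod_ring poly)"
    using fibotomic_mod_prime_power[of j, where 'p='p] unfolding assms fibp_prime_power_two[OF assms] by simp
  also have "2 ^ Suc j - 1 = (2 ^ j - 1) + (2 ^ j :: nat)" by (simp add: mult_2)
  finally have "poly_X ^ (2 ^ j - 1) * fibotomic_mod (2 ^ Suc j) = (poly_X ^ (2 ^ j - 1) * poly_X ^ (2 ^ j) :: 'p mod_ring poly)"
    by (simp only: power_add)
  then show ?thesis using poly_X_nonzero[where 'a="'p mod_ring"] by (simp only: mult_cancel_left power_eq_0_iff simp_thms)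
qed

theorem theorem3:
  fixes p m k n :: nat
  assumes p_def: "p = CARD('p::prime_card)"
    and m_pos: "m > 0"
    and cop: "coprime p m"
    and n_def: "n = p ^ k * m"
    and n_ge: "n \<ge> 2"
  shows
    "(m = 1 \<longrightarrow>
        (reduce_mod (fibotomic_hom n) :: 'p mod_ring poly poly) =
          (if p = 2 \<and> k = 1 then var_x
           else (var_x ^ 2 + 4 * var_y ^ 2) ^ (totient (p ^ k) div 2)))
   \<and> (m = 2 \<longrightarrow>
        (reduce_mod (fibotomic_hom n) :: 'p mod_ring poly poly) = var_x ^ totient (p ^ k))
   \<and> (m \<ge> 3 \<and> p > 2 \<longrightarrow>
        (\<exists>S :: 'p mod_ring poly poly set. finite S \<and> card S = totient m div delta_odd p m \<and>
           (\<forall>f\<in>S. irreducible f \<and> homogeneous (delta_odd p m) f \<and> monic_in_x f) \<and>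
           reduce_mod (fibotomic_hom n) = (\<Prod>f\<in>S. f ^ totient (p ^ k))))
   \<and> (m \<ge> 3 \<and> p = 2 \<longrightarrow>
        (\<exists>S :: 'p mod_ring poly poly set. finite S \<and> card S = totient m div (2 * delta_two m) \<and>
           (\<forall>f\<in>S. irreducible f \<and> homogeneous (delta_two m) f \<and> monic_in_x f) \<and>
           reduce_mod (fibotomic_hom n) = (\<Prod>f\<in>S. f ^ (2 * totient (2 ^ k)))))"
proof (intro conjI impI)
  have prime: "prime p" unfolding p_def by (rule prime_CARD)
  have cop': "coprime CARD('p) m" using cop by (simp only: p_def)
  let ?t = "totient (p ^ k)"
  have red: "(reduce_mod (fibotomic_hom n) :: 'p mod_ring poly poly) = homogenize (totient n) (fibotomic_mod n)"
    by (rule reduce_mod_fibotomic_hom[OF n_ge])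
  have tot: "totient n = totient m * ?t"
  proof -
    have "coprime (p ^ k) m" using cop by simp
    then have "totient n = ?t * totient m" unfolding n_def by (rule totient_mult_coprime)
    then show ?thesis by (simp only: mult.commute)
  qed
  have mod: "(fibotomic_mod n :: 'p mod_ring poly) = fibotomic_mod m ^ ?t" if "m \<ge> 2"
    using fibotomic_mod_prime_power_mult[OF cop' that] by (simp only: n_def p_def)
  have X: "homogenize i (poly_X ^ i) = (var_x ^ i :: 'p mod_ring poly poly)" for i
  proof -
    have "degree (poly_X :: 'p mod_ring poly) \<le> Suc 0" by (simp add: poly_X_def)
    from homogenize_power[OF this, of i] show ?thesis by (simp add: homogenize_poly_X)
  qed
  {
    assume "m = 1"
    then have n: "n = p ^ k" using n_def by simp
    with n_ge have "k \<noteq> 0" by (auto intro: Nat.gr0I)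
    then obtain j where k: "k = Suc j" by (cases k) auto
    show "(reduce_mod (fibotomic_hom n) :: 'p mod_ring poly poly) =
          (if p = 2 \<and> k = 1 then var_x else (var_x ^ 2 + 4 * var_y ^ 2) ^ (?t div 2))"
    proof (cases "p = 2")
      case True
      then have p2: "CARD('p) = 2" using p_def by simp
      have t: "totient (2 ^ Suc j) = 2 ^ j" using totient_prime_power_Suc[OF two_is_prime_nat, of j] by simp
      have "(4 :: 'p mod_ring poly poly) = [:2 * 2:]" by (simp add: numeral_poly)
      then have 4: "(4 :: 'p mod_ring poly poly) = 0" by (simp only: two_eq_0_char_2[OF p2]) simp
      have "(reduce_mod (fibotomic_hom n) :: 'p mod_ring poly poly) = var_x ^ 2 ^ j"
        unfolding red unfolding n k True t fibotomic_mod_prime_power_two[OF p2] by (rule X)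
      \<comment> \<open>Halving the exponent is exact only for \<open>j > 0\<close>. At
        \<open>j = 0\<close>, that is \<open>n = 2\<close>, the quotient \<open>1 div 2\<close> is
        0, whence the separate value x.\<close>
      moreover have "(var_x ^ 2) ^ (2 ^ j div 2) = (var_x ^ 2 ^ j :: 'p mod_ring poly poly)" if "j \<noteq> 0"
        using that by (cases j) (simp_all flip: power_mult)
      ultimately show ?thesis using True k t by (cases "j = 0") (simp_all add: 4)
    next
      case False
      then have odd: "odd CARD('p)" using prime prime_odd_nat[of p] prime_ge_2_nat[of p] p_def by simp
      have "even ?t" unfolding k using False prime totient_prime_power_Suc[OF prime, of j] prime_odd_nat[of p] prime_ge_2_nat[of p] by simp
      then have t: "?t = 2 * (?t div 2)" by simp
      have "(fibotomic_mod n :: 'p mod_ring poly) = (poly_X ^ 2 + 4) ^ (?t div 2)"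
        unfolding n k p_def by (rule fibotomic_mod_prime_power_odd[OF odd])
      moreover have "totient n = 2 * (?t div 2)" unfolding n by (rule t)
      ultimately have "homogenize (totient n) (fibotomic_mod n)
          = homogenize (2 * (?t div 2)) ((poly_X ^ 2 + 4 :: 'p mod_ring poly) ^ (?t div 2))"
        by (simp only:)
      also have "\<dots> = (var_x ^ 2 + 4 * var_y ^ 2) ^ (?t div 2)"
        by (subst homogenize_power) (simp_all only: discriminant_monic(1) homogenize_discriminant order_refl)
      finally show ?thesis using False red by (simp only: simp_thms if_False)
    qed
  next
    assume m: "m = 2"
    have "(fibotomic_mod n :: 'p mod_ring poly) = poly_X ^ ?t"
      using mod by (simp add: m fibotomic_mod_2)
    moreover have "totient n = ?t" using tot by (simp add: m)
    ultimately show "(reduce_mod (fibotomic_hom n) :: 'p mod_ring poly poly) = var_x ^ ?t"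
      unfolding red by (simp only: X)
  next
    assume "m \<ge> 3 \<and> p > 2"
    then have m: "m \<ge> 3" "m \<ge> 2" "m > 0" and "p > 2" by auto
    then have odd: "odd CARD('p)" using prime prime_odd_nat[of p] p_def by simp
    let ?Q = "fibotomic_mod m :: 'p mod_ring poly"
    have "\<not> f ^ 2 dvd ?Q" if "irreducible f" for f
    proof
      assume "f ^ 2 dvd ?Q"
      then have "f ^ 2 dvd fibp m" using fibotomic_mod_dvd_fibp[OF m(3)] by (rule dvd_trans)
      with fibp_mod_ring_squarefree_odd[OF odd cop' that] show False by simp
    qed
    moreover have "degree f = delta_odd p m" if "irreducible f" "f dvd ?Q" for f
      unfolding p_def
      by (rule degree_eq_delta_odd[OF odd cop' m(1) that(1) has_rank_factor_odd[OF odd cop' m(3) that]])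
    moreover have "delta_odd p m > 0" unfolding p_def by (rule delta_odd_pos[OF odd m(1) cop'])
    ultimately have "\<exists>S. finite S \<and> card S = degree ?Q div delta_odd p m \<and>
        (\<forall>f\<in>S. irreducible f \<and> homogeneous (delta_odd p m) f \<and> monic_in_x f) \<and>
        homogenize (degree ?Q * ?t) (?Q ^ ?t) = (\<Prod>f\<in>S. f ^ ?t)"
      using monic_fibotomic_mod[OF m(3)] by (intro homogeneous_factorization)
    then show "\<exists>S :: 'p mod_ring poly poly set. finite S \<and> card S = totient m div delta_odd p m \<and>
           (\<forall>f\<in>S. irreducible f \<and> homogeneous (delta_odd p m) f \<and> monic_in_x f) \<and>
           reduce_mod (fibotomic_hom n) = (\<Prod>f\<in>S. f ^ ?t)"
      unfolding red tot mod[OF m(2)] degree_fibotomic_mod[OF m(2)] .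
  next
    assume *: "m \<ge> 3 \<and> p = 2"
    then have m: "m \<ge> 3" "m \<ge> 2" "m > 0" by auto
    have p2: "CARD('p) = 2" using * p_def by simp
    have odd: "odd m" using cop * by simp
    \<comment> \<open>Factoring the square root \<open>T\<close> halves the number of factors and
      doubles the exponent.\<close>
    obtain T :: "'p mod_ring poly" where T: "fibotomic_mod m = T ^ 2"
      using fibotomic_mod_square_char_2[OF p2 odd] by (elim exE)
    have monic: "lead_coeff T = 1"
      using monic_fibotomic_mod[OF m(3), where 'p='p] unfolding T by (rule monic_if_square_monic_char_2[OF p2])
    have deg: "totient m = 2 * degree T"
    proof -
      have "T \<noteq> 0" using monic by auto
      then show ?thesis using degree_fibotomic_mod[OF m(2), where 'p='p] by (simp add: T degree_power_eq)
    qed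
    have "degree f = delta_two m" if "irreducible f" "f dvd T" for f
      by (rule degree_eq_delta_two[OF p2 m(1) odd that(1) sqrt_fibotomic_mod_char_2(2)[OF p2 odd that(1) T that(2)]])
    then have S: "\<exists>S. finite S \<and> card S = degree T div delta_two m \<and>
        (\<forall>f\<in>S. irreducible f \<and> homogeneous (delta_two m) f \<and> monic_in_x f) \<and>
        homogenize (degree T * (2 * ?t)) (T ^ (2 * ?t)) = (\<Prod>f\<in>S. f ^ (2 * ?t))"
      using monic delta_two_properties(1)[OF odd m(1)] sqrt_fibotomic_mod_char_2(1)[OF p2 odd _ T]
      by (intro homogeneous_factorization)
    have "totient n = degree T * (2 * ?t)" unfolding tot deg by (simp only: mult_ac)
    moreover have "(fibotomic_mod n :: 'p mod_ring poly) = T ^ (2 * ?t)"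
      unfolding mod[OF m(2)] T by (simp only: power_mult)
    ultimately have "(reduce_mod (fibotomic_hom n) :: 'p mod_ring poly poly)
        = homogenize (degree T * (2 * ?t)) (T ^ (2 * ?t))"
      unfolding red by (simp only:)
    moreover have "totient m div (2 * delta_two m) = degree T div delta_two m" unfolding deg by simp
    moreover have "totient (2 ^ k) = ?t" using * by simp
    ultimately show "\<exists>S :: 'p mod_ring poly poly set. finite S \<and> card S = totient m div (2 * delta_two m) \<and>
           (\<forall>f\<in>S. irreducible f \<and> homogeneous (delta_two m) f \<and> monic_in_x f) \<and>
           reduce_mod (fibotomic_hom n) = (\<Prod>f\<in>S. f ^ (2 * totient (2 ^ k)))"
      using S by (simp only:)
  }
qed

end
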